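(* Let $L>0$ and set $\omega_L=\frac{2\pi^2}{L^2+2\pi^2}$ and $\Omega_L=-\frac{4\pi^2}{L^2}$. (1) For every $\omega\in(\omega_L,1)$ and every $x_0\in\mathbb{T}_L$ there exists a periodic orbit of $\phi''=\frac{(\omega-\phi^2)\phi}{1-\phi^2}$ of period $L$ with smooth profile $\phi$ satisfying $0<\phi(x)<1$ and $\phi(x_0+x)=\phi(x_0-x)$ for all $x\in\mathbb{T}_L$. (2) For every $\omega\in(\Omega_L,1)$ and every $x_0\in\mathbb{T}_L$ there exists a periodic orbit of the same equation of period $L$ with smooth profile $\phi$ satisfying $-1<\phi(x)<1$ and $\phi(x_0+x)=-\phi(x_0-x)=\phi\left(x_0+\frac{L}{2}-x\right)$ for all $x\in\mathbb{T}_L$.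
   Context: $\mathbb{T}_L=\mathbb{R}/L\mathbb{Z}$ is the periodic domain of period $L$; functions on it are identified with $L$-periodic functions on $\mathbb{R}$. A periodic orbit of period $L$ of the second-order equation means a nonconstant real-valued solution with minimal (fundamental) period $L$. *)

theory Defs
  imports "HOL-Analysis.Analysis"
begin

definition smooth :: "(real \<Rightarrow> real) \<Rightarrow> bool" where
  "smooth \<phi> \<longleftrightarrow> (\<forall>n x. (deriv ^^ n) \<phi> differentiable (at x))"

text \<open>Functions on the circle of length \<open>L\<close> are represented by \<open>L\<close>-periodic functions on the reals.\<close>

definition has_fundamental_period :: "(real \<Rightarrow> real) \<Rightarrow> real \<Rightarrow> bool" where
  "has_fundamental_period \<phi> L \<longleftrightarrow>
     0 < L \<and> (\<forall>x. \<phi> (x + L) = \<phi> x) \<and>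
     (\<forall>T. 0 < T \<and> T < L \<longrightarrow> \<not> (\<forall>x. \<phi> (x + T) = \<phi> x))"

text \<open>The condition \<open>(\<phi> x)\<^sup>2 \<noteq> 1\<close> keeps the right-hand side away from its singularities, where HOL
  would otherwise read the quotient as zero.\<close>

definition solves_ode :: "real \<Rightarrow> (real \<Rightarrow> real) \<Rightarrow> bool" where
  "solves_ode \<omega> \<phi> \<longleftrightarrow>
     (\<exists>\<phi>'. \<forall>x. (\<phi> x)\<^sup>2 \<noteq> 1 \<and>
        (\<phi> has_real_derivative \<phi>' x) (at x) \<and>
        (\<phi>' has_real_derivative (\<omega> - (\<phi> x)\<^sup>2) * \<phi> x / (1 - (\<phi> x)\<^sup>2)) (at x))"

definition periodic_orbit :: "real \<Rightarrow> real \<Rightarrow> (real \<Rightarrow> real) \<Rightarrow> bool" where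
  "periodic_orbit \<omega> L \<phi> \<longleftrightarrow>
     solves_ode \<omega> \<phi> \<and> \<not> \<phi> constant_on UNIV \<and> has_fundamental_period \<phi> L"

definition omega_lower :: "real \<Rightarrow> real" where
  "omega_lower L = 2 * pi\<^sup>2 / (L\<^sup>2 + 2 * pi\<^sup>2)"

definition Omega_lower :: "real \<Rightarrow> real" where
  "Omega_lower L = - (4 * pi\<^sup>2 / L\<^sup>2)"

end

(* The equation has the first integral (phi')^2 = E - W(phi^2) with the convex function
   W(u) = -u - (1 - omega) ln (1 - u). On a closed level curve a substitution of the form
   phi = sqrt b sin theta (orbits around the origin) or phi^2 = p + (q - p) sin^2 theta (positive orbits)
   removes the turning points: theta' = g(theta) with g positive, continuous, even and pi-periodic. Hence
   theta is the inverse function of the integral of 1/g, no existence theory for differential equations is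
   needed, and the period is a nonsingular integral of 1/g that depends continuously on the amplitude.
   Towards one end of the amplitude range the period approaches that of the linearised equation (or becomes
   arbitrarily large); towards the homoclinic orbit it diverges logarithmically, and for large odd orbits it
   tends to zero. The intermediate value theorem yields every L in between. *)
theory Submission
  imports Defs "HOL-Real_Asymp.Real_Asymp"
begin

text \<open>The first integral is weaker than the equation: differentiating it gives the equation
  multiplied by \<open>\<phi>'\<close>, which says nothing at turning points. Since the phase moves
  strictly monotonically, turning points are isolated, and continuity of both sides closes the gaps.
  Both thresholds on \<open>\<omega>\<close> are linearised periods. At the origin with
  \<open>\<omega> < 0\<close> the frequency is \<open>sqrt (- \<omega>)\<close>, and its period
  exceeds \<open>L\<close> exactly when \<open>\<omega> > Omega_lower L\<close>. At the equilibrium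
  \<open>\<phi>\<^sup>2 = \<omega>\<close> with \<open>0 < \<omega> < 1\<close> the frequency is
  \<open>sqrt (2 * \<omega> / (1 - \<omega>))\<close>, and its period is below \<open>L\<close>
  exactly when \<open>\<omega> > omega_lower L\<close>. So small orbits provide the long periods
  around a center at the origin, but the short periods in the positive family.\<close>

section \<open>From the first integral back to the second-order equation\<close>

lemma has_real_derivative_of_square:
  fixes \<psi> :: "real \<Rightarrow> real"
  assumes "isCont \<psi> x" "\<psi> x \<noteq> 0"
    and "((\<lambda>y. (\<psi> y)\<^sup>2) has_real_derivative 2 * \<psi> x * c) (at x)"
  shows "(\<psi> has_real_derivative c) (at x)"
  unfolding has_field_derivative_iff
proof (rule Lim_transform_eventually)
  have "((\<lambda>y. ((\<psi> y)\<^sup>2 - (\<psi> x)\<^sup>2) / (y - x) / (\<psi> y + \<psi> x)) \<longlongrightarrow> 2 * \<psi> x * c / (\<psi> x + \<psi> x)) (at x)"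
    using assms by (intro tendsto_intros) (auto simp: has_field_derivative_iff isCont_def)
  with assms(2) show "((\<lambda>y. ((\<psi> y)\<^sup>2 - (\<psi> x)\<^sup>2) / (y - x) / (\<psi> y + \<psi> x)) \<longlongrightarrow> c) (at x)"
    by simp
  have "((\<lambda>y. \<psi> y + \<psi> x) \<longlongrightarrow> \<psi> x + \<psi> x) (at x)"
    using assms by (intro tendsto_intros) (auto simp: isCont_def)
  then have "\<forall>\<^sub>F y in at x. \<psi> y + \<psi> x \<noteq> 0"
    by (rule tendsto_imp_eventually_ne) (use assms(2) in auto)
  then show "\<forall>\<^sub>F y in at x. ((\<psi> y)\<^sup>2 - (\<psi> x)\<^sup>2) / (y - x) / (\<psi> y + \<psi> x) = (\<psi> y - \<psi> x) / (y - x)"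
    by eventually_elim (simp add: power2_eq_square square_diff_square_factored)
qed

text \<open>The fundamental theorem of calculus tolerates the one exceptional point
  \<open>x\<close>, so near \<open>x\<close> the function is a constant plus the integral of the
  continuous \<open>h\<close>, and that integral is differentiable at \<open>x\<close> too.\<close>

lemma has_real_derivative_removable:
  fixes \<psi> h :: "real \<Rightarrow> real"
  assumes cont: "\<And>x. isCont \<psi> x" "\<And>x. isCont h x"
    and ev: "\<forall>\<^sub>F y in at x. (\<psi> has_real_derivative h y) (at y)"
  shows "(\<psi> has_real_derivative h x) (at x)"
proof -
  obtain d where d: "d > 0" "\<And>y. y \<noteq> x \<Longrightarrow> dist y x < d \<Longrightarrow> (\<psi> has_real_derivative h y) (at y)"
    using ev unfolding eventually_at by blast
  define a where "a = x - d / 2"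
  define b where "b = x + d / 2"
  have conth: "continuous_on S h" "continuous_on S \<psi>" for S
    using cont by (auto intro: continuous_at_imp_continuous_on)
  have eq: "\<psi> a + integral {a..y} h = \<psi> y" if "y \<in> {a..b}" for y
  proof -
    have "(h has_integral (\<psi> y - \<psi> a)) {a..y}"
    proof (rule fundamental_theorem_of_calculus_strong[where S = "{x}"])
      show "(\<psi> has_vector_derivative h z) (at z)" if "z \<in> {a..y} - {x}" for z
        using that \<open>y \<in> {a..b}\<close> d(1) unfolding has_real_derivative_iff_has_vector_derivative[symmetric]
        by (intro d(2)) (auto simp: a_def b_def dist_real_def)
    qed (use that conth in auto)
    then show ?thesis by (simp add: integral_unique)
  qed
  have x: "x \<in> {a<..<b}" using d(1) by (simp add: a_def b_def)
  have "((\<lambda>y. \<psi> a + integral {a..y} h) has_real_derivative h x) (at x within {a..b})"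
    using DERIV_add[OF DERIV_const[of "\<psi> a"] integral_has_real_derivative[OF conth(1)[of "{a..b}"]], of x] x
    by simp
  then have "(\<psi> has_real_derivative h x) (at x within {a..b})"
  proof (rule has_field_derivative_transform_within[where d = 1])
    show "x \<in> {a..b}" using x by simp
    show "\<psi> a + integral {a..y} h = \<psi> y" if "y \<in> {a..b}" for y
      by (rule eq) (rule that)
  qed simp
  then have "(\<psi> has_real_derivative h x) (at x within {a<..<b})"
    by (rule has_field_derivative_subset) (rule greaterThanLessThan_subseteq_atLeastAtMost_iff[THEN iffD2], simp)
  moreover have "at x within {a<..<b} = at x"
    using x by (intro at_within_open open_greaterThanLessThan)
  ultimately show ?thesis by metis
qed

text \<open>Differentiating the energy identity gives
  \<open>2 * \<psi> * \<psi>' = 2 * f \<phi> * \<psi>\<close>. Cancelling \<open>\<psi>\<close> is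
  possible off its zeros, which are isolated and hence removable.\<close>

lemma second_order_of_first_integral:
  fixes \<phi> \<psi> f Q :: "real \<Rightarrow> real"
  assumes \<phi>: "\<And>x. (\<phi> has_real_derivative \<psi> x) (at x)"
    and \<psi>: "\<And>x. isCont \<psi> x" "\<And>x. \<forall>\<^sub>F y in at x. \<psi> y \<noteq> 0"
    and energy: "\<And>x. (\<psi> x)\<^sup>2 = Q (\<phi> x)"
    and Q: "\<And>x. (Q has_real_derivative 2 * f (\<phi> x)) (at (\<phi> x))"
    and f: "\<And>x. isCont (\<lambda>x. f (\<phi> x)) x"
  shows "(\<psi> has_real_derivative f (\<phi> x)) (at x)"
proof -
  have *: "(\<psi> has_real_derivative f (\<phi> y)) (at y)" if "\<psi> y \<noteq> 0" for y
  proof (rule has_real_derivative_of_square[OF \<psi>(1) that])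
    show "((\<lambda>y. (\<psi> y)\<^sup>2) has_real_derivative 2 * \<psi> y * f (\<phi> y)) (at y)"
      using DERIV_chain2[OF Q \<phi>] by (simp add: energy mult_ac)
  qed
  show ?thesis
    by (rule has_real_derivative_removable[OF \<psi>(1) f])
       (use \<psi>(2)[of x] * in \<open>auto elim: eventually_mono\<close>)
qed

lemma eventually_neq_of_deriv_nonzero:
  fixes f :: "real \<Rightarrow> real"
  assumes "(f has_real_derivative D) (at x)" "D \<noteq> 0"
  shows "\<forall>\<^sub>F y in at x. f y \<noteq> f x"
proof -
  have "\<forall>\<^sub>F y in at x. (f y - f x) / (y - x) \<noteq> 0"
    using assms unfolding has_field_derivative_iff by (rule tendsto_imp_eventually_ne)
  then show ?thesis by eventually_elim auto
qed

section \<open>The phase flow on the line\<close>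

text \<open>Each symmetry of \<open>g\<close> becomes a functional equation for the antiderivative
  \<open>X\<close> of \<open>1 / g\<close>, because both sides have equal derivatives and agree at
  0. Inversion then carries it over to \<open>\<Theta>\<close>.\<close>

lemma periodic_flow:
  fixes g :: "real \<Rightarrow> real" and P :: real
  assumes cont: "continuous_on UNIV g" and pos: "\<And>t. 0 < g t" and "0 < P"
    and even: "\<And>t. g (- t) = g t" and per: "\<And>t. g (t + P) = g t"
  defines "T \<equiv> integral {0..P} (\<lambda>t. 1 / g t)"
  obtains \<Theta> where "\<And>x. (\<Theta> has_real_derivative g (\<Theta> x)) (at x)" "strict_mono \<Theta>"
    "\<Theta> 0 = 0" "\<And>x. \<Theta> (- x) = - \<Theta> x" "\<And>x. \<Theta> (x + T) = \<Theta> x + P" "0 < T"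
proof -
  have isC: "isCont (\<lambda>t. 1 / g t) t" for t
    using cont pos[of t] by (auto intro!: continuous_intros simp: continuous_on_eq_continuous_at)
  obtain F where F0: "\<forall>x. -\<infinity> < ereal x \<longrightarrow> ereal x < \<infinity> \<longrightarrow> (F has_vector_derivative 1 / g x) (at x)"
    using einterval_antiderivative[of "-\<infinity>" "\<infinity>" "\<lambda>t. 1 / g t"] isC by auto
  define X where "X t = F t - F 0" for t
  have X: "(X has_real_derivative 1 / g t) (at t)" for t
    using F0 unfolding X_def has_real_derivative_iff_has_vector_derivative
    by (auto intro!: derivative_eq_intros)
  have Xmono: "X s < X t" if "s < t" for s t
    by (rule DERIV_pos_imp_increasing[OF that]) (use X pos in \<open>auto intro!: exI\<close>)
  have X0: "X 0 = 0" by (simp add: X_def)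
  have const: "f s = f t" if "\<And>t. (f has_real_derivative 0) (at t)" for f :: "real \<Rightarrow> real" and s t
    using DERIV_isconst_all that by blast
  have Xodd: "X (- t) = - X t" for t
  proof -
    have "((\<lambda>t. X t + X (- t)) has_real_derivative 0) (at t)" for t
      using even[of t] by (auto intro!: derivative_eq_intros DERIV_chain2[OF X])
    from const[OF this, of t 0] show ?thesis by (simp add: X0)
  qed
  have T: "T = X P"
  proof -
    have "((\<lambda>t. 1 / g t) has_integral (X P - X 0)) {0..P}"
      using X \<open>0 < P\<close> by (intro fundamental_theorem_of_calculus)
       (auto simp: has_real_derivative_iff_has_vector_derivative[symmetric] intro: has_field_derivative_at_within)
    then show ?thesis by (simp add: T_def X0 integral_unique)
  qed
  have Tpos: "0 < T" using Xmono[OF \<open>0 < P\<close>] T X0 by simp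
  have Xper: "X (t + P) = X t + T" for t
  proof -
    have "((\<lambda>t. X (t + P) - X t) has_real_derivative 0) (at t)" for t
      using per[of t] by (auto intro!: derivative_eq_intros DERIV_chain2[OF X])
    from const[OF this, of t 0] show ?thesis by (simp add: X0 T)
  qed
  \<comment> \<open>Linear growth along the multiples of \<open>P\<close> makes \<open>X\<close>
    unbounded in both directions, hence onto.\<close>
  have Xn: "X (real n * P) = real n * T" for n
    by (induction n) (simp_all add: X0 distrib_right add.commute[of P] add.commute[of T] Xper)
  have Xcont: "isCont X t" for t using X DERIV_isCont by blast
  have surj: "\<exists>t. X t = y" for y
  proof -
    obtain n where n: "\<bar>y\<bar> < real n * T"
      using reals_Archimedean3[OF Tpos] by blast
    have "X (- (real n * P)) \<le> y" "y \<le> X (real n * P)"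
      using n unfolding Xodd Xn by linarith+
    moreover have "- (real n * P) \<le> real n * P" using \<open>0 < P\<close> by simp
    ultimately show ?thesis using IVT[of X "- (real n * P)" y "real n * P"] Xcont by blast
  qed
  have inj: "inj X" by (rule injI) (metis Xmono less_irrefl linorder_neqE_linordered_idom)
  define \<Theta> where "\<Theta> = inv X"
  have \<Theta>X: "\<Theta> (X t) = t" for t by (simp add: \<Theta>_def inj)
  have X\<Theta>: "X (\<Theta> y) = y" for y unfolding \<Theta>_def by (rule f_inv_into_f) (use surj[of y] in blast)
  have "isCont \<Theta> (X t)" for t
    by (rule isCont_inverse_function[where d = 1]) (auto simp: \<Theta>X Xcont)
  then have "isCont \<Theta> y" for y using X\<Theta> by metis
  then have "(\<Theta> has_real_derivative inverse (1 / g (\<Theta> y))) (at y)" for y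
    using pos[of "\<Theta> y"] X\<Theta> by (intro DERIV_inverse_function[OF X, of _ _ "y - 1" "y + 1"]) auto
  then have 1: "(\<Theta> has_real_derivative g (\<Theta> y)) (at y)" for y by simp
  have 2: "strict_mono \<Theta>"
    by (rule strict_monoI) (metis X\<Theta> Xmono linorder_neqE_linordered_idom order_less_asym)
  have 3: "\<Theta> 0 = 0" using \<Theta>X[of 0] X0 by simp
  have 4: "\<Theta> (- x) = - \<Theta> x" for x by (metis X\<Theta> \<Theta>X Xodd)
  have 5: "\<Theta> (x + T) = \<Theta> x + P" for x by (metis X\<Theta> \<Theta>X Xper)
  show ?thesis using that 1 2 3 4 5 Tpos by blast
qed

section \<open>Smoothness of solutions\<close>

text \<open>This algebra is closed under differentiation when \<open>\<phi>\<close> solves the equation and \<open>\<psi> = \<phi>'\<close>.\<close>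

inductive_set ode_algebra :: "(real \<Rightarrow> real) \<Rightarrow> (real \<Rightarrow> real) \<Rightarrow> (real \<Rightarrow> real) set"
  for \<phi> \<psi> :: "real \<Rightarrow> real" where
  alg_const: "(\<lambda>x. c) \<in> ode_algebra \<phi> \<psi>"
| alg_fun: "\<phi> \<in> ode_algebra \<phi> \<psi>"
| alg_deriv: "\<psi> \<in> ode_algebra \<phi> \<psi>"
| alg_inverse: "(\<lambda>x. 1 / (1 - (\<phi> x)\<^sup>2)) \<in> ode_algebra \<phi> \<psi>"
| alg_add: "f \<in> ode_algebra \<phi> \<psi> \<Longrightarrow> g \<in> ode_algebra \<phi> \<psi> \<Longrightarrow> (\<lambda>x. f x + g x) \<in> ode_algebra \<phi> \<psi>"
| alg_mult: "f \<in> ode_algebra \<phi> \<psi> \<Longrightarrow> g \<in> ode_algebra \<phi> \<psi> \<Longrightarrow> (\<lambda>x. f x * g x) \<in> ode_algebra \<phi> \<psi>"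

text \<open>Closure of the algebra under differentiation puts every iterated derivative of
  \<open>\<phi>\<close> into it, so no formula for the n-th derivative has to be found.\<close>

lemma smooth_if_solves_ode:
  assumes "solves_ode \<omega> \<phi>"
  shows "smooth \<phi>"
proof -
  from assms obtain \<psi> where ne: "\<And>x. (\<phi> x)\<^sup>2 \<noteq> 1"
    and \<phi>: "\<And>x. (\<phi> has_real_derivative \<psi> x) (at x)"
    and \<psi>: "\<And>x. (\<psi> has_real_derivative (\<omega> - (\<phi> x)\<^sup>2) * \<phi> x / (1 - (\<phi> x)\<^sup>2)) (at x)"
    unfolding solves_ode_def by blast
  let ?A = "ode_algebra \<phi> \<psi>" and ?r = "\<lambda>x. 1 / (1 - (\<phi> x)\<^sup>2)"
  note alg = alg_const[of _ \<phi> \<psi>] alg_fun[of \<phi> \<psi>] alg_deriv[of \<psi> \<phi>] alg_inverse[of \<phi> \<psi>] alg_add[of _ \<phi> \<psi>] alg_mult[of _ \<phi> \<psi>]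
  have "\<exists>h' \<in> ?A. \<forall>x. (h has_real_derivative h' x) (at x)" if "h \<in> ?A" for h
    using that
  proof induction
    case (alg_const c)
    then show ?case by (intro bexI[of _ "\<lambda>x. 0"]) (auto intro: alg)
  next
    case alg_fun
    then show ?case using \<phi> alg by blast
  next
    case alg_deriv
    have "(\<lambda>x. (\<omega> + (-1) * (\<phi> x * \<phi> x)) * (\<phi> x * ?r x)) \<in> ?A"
      by (intro alg)
    moreover have "(\<lambda>x. (\<omega> + (-1) * (\<phi> x * \<phi> x)) * (\<phi> x * ?r x)) = (\<lambda>x. (\<omega> - (\<phi> x)\<^sup>2) * \<phi> x / (1 - (\<phi> x)\<^sup>2))"
      by (auto simp: power2_eq_square)
    ultimately show ?case using \<psi> by (intro bexI[of _ "\<lambda>x. (\<omega> - (\<phi> x)\<^sup>2) * \<phi> x / (1 - (\<phi> x)\<^sup>2)"]) auto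
  next
    case alg_inverse
    have "(\<lambda>x. 2 * (\<phi> x * \<psi> x) * (?r x * ?r x)) \<in> ?A"
      by (intro alg)
    moreover have "(?r has_real_derivative 2 * (\<phi> x * \<psi> x) * (?r x * ?r x)) (at x)" for x
      using ne[of x] by (auto intro!: derivative_eq_intros \<phi> simp: power2_eq_square field_simps)
    ultimately show ?case by (intro bexI[of _ "\<lambda>x. 2 * (\<phi> x * \<psi> x) * (?r x * ?r x)"]) blast+
  next
    case (alg_add f g)
    then obtain f' g' where "f' \<in> ?A" "g' \<in> ?A" "\<And>x. (f has_real_derivative f' x) (at x)"
      "\<And>x. (g has_real_derivative g' x) (at x)" by blast
    then show ?case
      by (intro bexI[of _ "\<lambda>x. f' x + g' x"]) (auto intro: alg DERIV_add)
  next
    case (alg_mult f g)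
    then obtain f' g' where "f' \<in> ?A" "g' \<in> ?A" "\<And>x. (f has_real_derivative f' x) (at x)"
      "\<And>x. (g has_real_derivative g' x) (at x)" by blast
    then show ?case using alg_mult.hyps
      by (intro bexI[of _ "\<lambda>x. f' x * g x + g' x * f x"]) (auto intro!: alg DERIV_mult)
  qed
  then have *: "deriv h \<in> ?A \<and> (\<forall>x. h differentiable (at x))" if "h \<in> ?A" for h
    using that by (metis DERIV_imp_deriv ext real_differentiable_def)
  have "(deriv ^^ n) \<phi> \<in> ?A" for n
    by (induction n) (auto simp: * alg_fun)
  then show ?thesis unfolding smooth_def using * by blast
qed

section \<open>Divided differences of the logarithm\<close>

text \<open>Divided differences of \<open>- ln (1 - u)\<close> at two and three points, obtained from
  \<open>- ln (1 - u) = integral {0..1} (\<lambda>s. u / (1 - s * u))\<close>. Unlike difference quotients they remain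
  jointly continuous when the points coincide.\<close>

definition log_dd2 :: "real \<Rightarrow> real \<Rightarrow> real" where
  "log_dd2 a b = integral {0..1} (\<lambda>s. 1 / ((1 - s * a) * (1 - s * b)))"

definition log_dd3 :: "real \<Rightarrow> real \<Rightarrow> real \<Rightarrow> real" where
  "log_dd3 a b c = integral {0..1} (\<lambda>s. s / ((1 - s * a) * (1 - s * b) * (1 - s * c)))"

lemma one_minus_mult_pos:
  fixes a s :: real
  assumes "a < 1" "s \<in> {0..1}"
  shows "0 < 1 - s * a"
proof (cases "0 \<le> a")
  case True
  then have "s * a \<le> a" using assms by (simp add: mult_left_le_one_le)
  then show ?thesis using assms by linarith
next
  case False
  then have "s * a \<le> 0" using assms by (simp add: mult_nonneg_nonpos)
  then show ?thesis by linarith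
qed

lemma log_dd2_integrable [intro]:
  fixes a b :: real
  assumes "a < 1" "b < 1"
  shows "(\<lambda>s. 1 / ((1 - s * a) * (1 - s * b))) integrable_on {0..1}"
  using one_minus_mult_pos[OF assms(1)] one_minus_mult_pos[OF assms(2)]
  by (intro integrable_continuous_real continuous_intros) fastforce

lemma log_dd3_integrable [intro]:
  fixes a b c :: real
  assumes "a < 1" "b < 1" "c < 1"
  shows "(\<lambda>s. s / ((1 - s * a) * (1 - s * b) * (1 - s * c))) integrable_on {0..1}"
  using one_minus_mult_pos[OF assms(1)] one_minus_mult_pos[OF assms(2)] one_minus_mult_pos[OF assms(3)]
  by (intro integrable_continuous_real continuous_intros) fastforce

lemma continuous_on_log_dd2 [continuous_intros]:
  assumes "continuous_on S f" "continuous_on S g" "\<And>x. x \<in> S \<Longrightarrow> f x < 1" "\<And>x. x \<in> S \<Longrightarrow> g x < 1"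
  shows "continuous_on S (\<lambda>x. log_dd2 (f x) (g x))"
proof -
  have "continuous_on S (\<lambda>x. integral {0..1} (\<lambda>s. 1 / ((1 - s * f x) * (1 - s * g x))))"
  proof (rule integral_continuous_on_param[where a = "0::real" and b = 1, unfolded cbox_interval])
    have "continuous_on (S \<times> {0..1}) (\<lambda>z. f (fst z))" "continuous_on (S \<times> {0..1}) (\<lambda>z. g (fst z))"
      by (auto intro!: continuous_on_compose2[OF assms(1)] continuous_on_compose2[OF assms(2)] continuous_intros)
    then show "continuous_on (S \<times> {0..1}) (\<lambda>(x, s). 1 / ((1 - s * f x) * (1 - s * g x)))"
      using one_minus_mult_pos[OF assms(3), THEN less_imp_neq, THEN not_sym] one_minus_mult_pos[OF assms(4), THEN less_imp_neq, THEN not_sym]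
      by (auto simp: case_prod_beta intro!: continuous_intros)
  qed
  then show ?thesis by (simp add: log_dd2_def)
qed

lemma continuous_on_log_dd3 [continuous_intros]:
  assumes "continuous_on S f" "continuous_on S g" "continuous_on S h"
    and "\<And>x. x \<in> S \<Longrightarrow> f x < 1" "\<And>x. x \<in> S \<Longrightarrow> g x < 1" "\<And>x. x \<in> S \<Longrightarrow> h x < 1"
  shows "continuous_on S (\<lambda>x. log_dd3 (f x) (g x) (h x))"
proof -
  have "continuous_on S (\<lambda>x. integral {0..1} (\<lambda>s. s / ((1 - s * f x) * (1 - s * g x) * (1 - s * h x))))"
  proof (rule integral_continuous_on_param[where a = "0::real" and b = 1, unfolded cbox_interval])
    have "continuous_on (S \<times> {0..1}) (\<lambda>z. f (fst z))" "continuous_on (S \<times> {0..1}) (\<lambda>z. g (fst z))"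
      "continuous_on (S \<times> {0..1}) (\<lambda>z. h (fst z))"
      by (auto intro!: continuous_on_compose2[OF assms(1)] continuous_on_compose2[OF assms(2)]
        continuous_on_compose2[OF assms(3)] continuous_intros)
    then show "continuous_on (S \<times> {0..1}) (\<lambda>(x, s). s / ((1 - s * f x) * (1 - s * g x) * (1 - s * h x)))"
      using one_minus_mult_pos[OF assms(4), THEN less_imp_neq, THEN not_sym] one_minus_mult_pos[OF assms(5), THEN less_imp_neq, THEN not_sym] one_minus_mult_pos[OF assms(6), THEN less_imp_neq, THEN not_sym]
      by (auto simp: case_prod_beta intro!: continuous_intros)
  qed
  then show ?thesis by (simp add: log_dd3_def)
qed

lemma log_dd2_eq:
  assumes "a < 1" "b < 1"
  shows "(a - b) * log_dd2 a b = ln (1 - b) - ln (1 - a)"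
proof -
  have "((\<lambda>s. (a - b) * (1 / ((1 - s * a) * (1 - s * b)))) has_integral
      ((ln (1 - 1 * b) - ln (1 - 1 * a)) - (ln (1 - 0 * b) - ln (1 - 0 * a)))) {0..1}"
  proof (rule fundamental_theorem_of_calculus)
    fix s :: real assume s: "s \<in> {0..1}"
    show "((\<lambda>s. ln (1 - s * b) - ln (1 - s * a)) has_vector_derivative (a - b) * (1 / ((1 - s * a) * (1 - s * b))))
        (at s within {0..1})"
      using one_minus_mult_pos[OF assms(1) s] one_minus_mult_pos[OF assms(2) s]
      unfolding has_real_derivative_iff_has_vector_derivative[symmetric]
      by (auto intro!: derivative_eq_intros simp: field_simps)
  qed simp
  then show ?thesis unfolding log_dd2_def
    by (simp add: integral_unique flip: integral_mult_right)
qed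

text \<open>The usual recursion for divided differences, with \<open>b\<close> as common node; under
  the integral sign it is a partial fraction identity.\<close>

lemma log_dd3_eq:
  assumes "a < 1" "b < 1" "c < 1"
  shows "(c - a) * log_dd3 a b c = log_dd2 b c - log_dd2 b a"
proof -
  have "(c - a) * log_dd3 a b c =
      integral {0..1} (\<lambda>s. 1 / ((1 - s * b) * (1 - s * c)) - 1 / ((1 - s * b) * (1 - s * a)))"
    unfolding log_dd3_def integral_mult_right[symmetric]
  proof (rule integral_cong)
    fix s :: real assume s: "s \<in> {0..1}"
    show "(c - a) * (s / ((1 - s * a) * (1 - s * b) * (1 - s * c))) =
        1 / ((1 - s * b) * (1 - s * c)) - 1 / ((1 - s * b) * (1 - s * a))"
      using one_minus_mult_pos[OF assms(1) s] one_minus_mult_pos[OF assms(2) s] one_minus_mult_pos[OF assms(3) s]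
      by (simp add: divide_simps) (simp add: algebra_simps)
  qed
  also have "\<dots> = log_dd2 b c - log_dd2 b a"
    unfolding log_dd2_def using assms by (intro integral_diff) auto
  finally show ?thesis .
qed

lemma log_dd2_mono:
  assumes "a \<le> a'" "b \<le> b'" "a' < 1" "b' < 1"
  shows "log_dd2 a b \<le> log_dd2 a' b'"
  unfolding log_dd2_def
proof (rule integral_le)
  fix s :: real assume s: "s \<in> {0..1}"
  have "0 < (1 - s * a') * (1 - s * b')"
    using one_minus_mult_pos[OF assms(3) s] one_minus_mult_pos[OF assms(4) s] by simp
  moreover have "(1 - s * a') * (1 - s * b') \<le> (1 - s * a) * (1 - s * b)"
    using assms one_minus_mult_pos[OF assms(3) s] one_minus_mult_pos[OF assms(4) s]
      mult_left_mono[OF assms(1), of s] mult_left_mono[OF assms(2), of s] s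
    by (intro mult_mono) auto
  ultimately show "1 / ((1 - s * a) * (1 - s * b)) \<le> 1 / ((1 - s * a') * (1 - s * b'))"
    by (intro divide_left_mono) auto
qed (use assms in auto)

lemma log_dd3_mono:
  assumes "a \<le> a'" "b \<le> b'" "c \<le> c'" "a' < 1" "b' < 1" "c' < 1"
  shows "log_dd3 a b c \<le> log_dd3 a' b' c'"
  unfolding log_dd3_def
proof (rule integral_le)
  fix s :: real assume s: "s \<in> {0..1}"
  note pos = one_minus_mult_pos[OF assms(4) s] one_minus_mult_pos[OF assms(5) s] one_minus_mult_pos[OF assms(6) s]
  have p: "0 < (1 - s * a') * (1 - s * b') * (1 - s * c')" using pos by simp
  moreover have "(1 - s * a') * (1 - s * b') * (1 - s * c') \<le> (1 - s * a) * (1 - s * b) * (1 - s * c)"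
    using assms pos s mult_left_mono[OF assms(1), of s] mult_left_mono[OF assms(2), of s]
      mult_left_mono[OF assms(3), of s]
    by (intro mult_mono mult_nonneg_nonneg) auto
  ultimately show "s / ((1 - s * a) * (1 - s * b) * (1 - s * c)) \<le> s / ((1 - s * a') * (1 - s * b') * (1 - s * c'))"
    using s by (intro divide_left_mono) auto
qed (use assms in auto)

lemma log_dd2_diag:
  assumes "a < 1"
  shows "log_dd2 a a = 1 / (1 - a)"
proof -
  have "((\<lambda>s. 1 / ((1 - s * a) * (1 - s * a))) has_integral (1 / (1 - 1 * a) - 0 / (1 - 0 * a))) {0..1}"
  proof (rule fundamental_theorem_of_calculus)
    fix s :: real assume s: "s \<in> {0..1}"
    show "((\<lambda>s. s / (1 - s * a)) has_vector_derivative 1 / ((1 - s * a) * (1 - s * a))) (at s within {0..1})"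
      using one_minus_mult_pos[OF assms s] unfolding has_real_derivative_iff_has_vector_derivative[symmetric]
      by (auto intro!: derivative_eq_intros simp: field_simps)
  qed simp
  then show ?thesis by (simp add: log_dd2_def integral_unique)
qed

text \<open>Coinciding nodes give half the second derivative of \<open>- ln (1 - u)\<close>.
  Together with monotonicity in the nodes this turns into explicit bounds on
  \<open>log_dd3\<close>.\<close>

lemma log_dd3_diag:
  assumes "a < 1"
  shows "log_dd3 a a a = 1 / (2 * (1 - a)\<^sup>2)"
proof -
  have "((\<lambda>s. s / ((1 - s * a) * (1 - s * a) * (1 - s * a))) has_integral
      (1\<^sup>2 / (2 * (1 - 1 * a)\<^sup>2) - 0\<^sup>2 / (2 * (1 - 0 * a)\<^sup>2))) {0..1}"
  proof (rule fundamental_theorem_of_calculus)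
    fix s :: real assume s: "s \<in> {0..1}"
    show "((\<lambda>s. s\<^sup>2 / (2 * (1 - s * a)\<^sup>2)) has_vector_derivative s / ((1 - s * a) * (1 - s * a) * (1 - s * a)))
        (at s within {0..1})"
      using one_minus_mult_pos[OF assms s] unfolding has_real_derivative_iff_has_vector_derivative[symmetric]
      apply (auto intro!: derivative_eq_intros)
      apply (simp add: divide_simps)
      by (simp add: algebra_simps power2_eq_square power4_eq_xxxx)
  qed simp
  then show ?thesis by (simp add: log_dd3_def integral_unique)
qed

lemma log_dd3_pos:
  assumes "0 \<le> a" "a < 1" "0 \<le> b" "b < 1" "0 \<le> c" "c < 1"
  shows "0 < log_dd3 a b c"
  using log_dd3_mono[of 0 a 0 b 0 c] assms by (simp add: log_dd3_diag)

section \<open>Continuity and bounds for period integrals\<close>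

lemma continuous_on_integral_inverse:
  fixes g :: "real \<Rightarrow> real \<Rightarrow> real"
  assumes "continuous_on (S \<times> {a..b}) (\<lambda>(z, t). g z t)" "\<And>z t. z \<in> S \<Longrightarrow> 0 < g z t"
  shows "continuous_on S (\<lambda>z. integral {a..b} (\<lambda>t. 1 / g z t))"
proof (rule integral_continuous_on_param[where a = a and b = b, unfolded cbox_interval])
  show "continuous_on (S \<times> {a..b}) (\<lambda>(z, t). 1 / g z t)"
    using assms(1) assms(2)[THEN less_imp_neq, THEN not_sym]
    by (auto simp: case_prod_beta intro!: continuous_intros)
qed

text \<open>A speed growing at most linearly away from a slow point has a passage time of at least
  order \<open>ln (1 / \<epsilon>)\<close>. This yields the long periods near homoclinic
  orbits.\<close>

lemma integral_inverse_ge_ln: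
  fixes g :: "real \<Rightarrow> real"
  assumes "continuous_on {0..b} g" "\<And>t. t \<in> {0..b} \<Longrightarrow> 0 < g t"
    and "\<And>t. t \<in> {0..b} \<Longrightarrow> g t \<le> \<epsilon> + C * t" and "0 < \<epsilon>" "0 < C" "0 \<le> b"
  shows "ln (1 + C * b / \<epsilon>) / C \<le> integral {0..b} (\<lambda>t. 1 / g t)"
proof -
  have pos: "0 < \<epsilon> + C * t" if "t \<in> {0..b}" for t
    using assms that by (simp add: add_pos_nonneg)
  have I: "((\<lambda>t. 1 / (\<epsilon> + C * t)) has_integral (ln (\<epsilon> + C * b) / C - ln (\<epsilon> + C * 0) / C)) {0..b}"
  proof (rule fundamental_theorem_of_calculus)
    fix t assume "t \<in> {0..b}"
    then show "((\<lambda>t. ln (\<epsilon> + C * t) / C) has_vector_derivative 1 / (\<epsilon> + C * t)) (at t within {0..b})"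
      using pos[of t] assms unfolding has_real_derivative_iff_has_vector_derivative[symmetric]
      by (auto intro!: derivative_eq_intros)
  qed fact
  have "1 + C * b / \<epsilon> = (\<epsilon> + C * b) / \<epsilon>" using assms by (simp add: field_simps)
  then have "ln (1 + C * b / \<epsilon>) / C = ln (\<epsilon> + C * b) / C - ln (\<epsilon> + C * 0) / C"
    using assms pos[of b] by (simp add: ln_div diff_divide_distrib)
  also have "\<dots> = integral {0..b} (\<lambda>t. 1 / (\<epsilon> + C * t))"
    using I by (simp add: integral_unique)
  also have "\<dots> \<le> integral {0..b} (\<lambda>t. 1 / g t)"
  proof (rule integral_le)
    show "(\<lambda>t. 1 / (\<epsilon> + C * t)) integrable_on {0..b}" using I by blast
    show "(\<lambda>t. 1 / g t) integrable_on {0..b}"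
      using assms by (intro integrable_continuous_real continuous_intros) force+
    show "1 / (\<epsilon> + C * t) \<le> 1 / g t" if "t \<in> {0..b}" for t
      using assms(2,3)[OF that] by (intro divide_left_mono) auto
  qed
  finally show ?thesis .
qed

lemma integral_inverse_le:
  fixes g :: "real \<Rightarrow> real"
  assumes "continuous_on {0..b} g" "\<And>t. t \<in> {0..b} \<Longrightarrow> c \<le> g t" "0 < c" "0 \<le> b"
  shows "integral {0..b} (\<lambda>t. 1 / g t) \<le> b / c"
proof -
  have "integral {0..b} (\<lambda>t. 1 / g t) \<le> integral {0..b} (\<lambda>t. 1 / c)"
  proof (rule integral_le)
    show "(\<lambda>t. 1 / g t) integrable_on {0..b}"
      using assms by (intro integrable_continuous_real continuous_intros) force+
    show "1 / g t \<le> 1 / c" if "t \<in> {0..b}" for t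
      using assms(2)[OF that] assms(3) by (intro divide_left_mono) auto
  qed (rule integrable_const_ivl)
  then show ?thesis using assms(4) by simp
qed

lemma integral_inverse_ge:
  fixes g :: "real \<Rightarrow> real"
  assumes "continuous_on {0..b} g" "\<And>t. t \<in> {0..b} \<Longrightarrow> 0 < g t" "\<And>t. t \<in> {0..b} \<Longrightarrow> g t \<le> c" "0 \<le> b"
  shows "b / c \<le> integral {0..b} (\<lambda>t. 1 / g t)"
proof -
  have "integral {0..b} (\<lambda>t. 1 / c) \<le> integral {0..b} (\<lambda>t. 1 / g t)"
  proof (rule integral_le)
    show "(\<lambda>t. 1 / g t) integrable_on {0..b}"
      using assms by (intro integrable_continuous_real continuous_intros) force+
    show "1 / c \<le> 1 / g t" if "t \<in> {0..b}" for t
      using assms(2,3)[OF that] by (intro divide_left_mono) auto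
  qed (rule integrable_const_ivl)
  then show ?thesis using assms(4) by simp
qed

section \<open>Solutions from a phase\<close>

lemma eventually_nonzero_of_simple_zeros:
  fixes f :: "real \<Rightarrow> real"
  assumes "(f has_real_derivative D) (at x)" "f x = 0 \<Longrightarrow> D \<noteq> 0"
  shows "\<forall>\<^sub>F y in at x. f y \<noteq> 0"
proof (cases "f x = 0")
  case True
  then show ?thesis using eventually_neq_of_deriv_nonzero[OF assms(1)] assms(2) by simp
next
  case False
  have "(f \<longlongrightarrow> f x) (at x)" using DERIV_isCont[OF assms(1)] by (simp add: isCont_def)
  then show ?thesis using False by (rule tendsto_imp_eventually_ne)
qed

text \<open>Shared by both families: \<open>P\<close> expresses \<open>\<phi>\<close> through the
  phase and \<open>C\<close> is the energy level. Isolated zeros of \<open>P'\<close> mean isolated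
  turning points, as required to recover the second-order equation.\<close>

lemma solves_ode_of_phase:
  fixes \<Theta> g P P' :: "real \<Rightarrow> real"
  assumes \<Theta>: "\<And>x. (\<Theta> has_real_derivative g (\<Theta> x)) (at x)" "inj \<Theta>"
    and g: "continuous_on UNIV g" "\<And>t. 0 < g t"
    and P: "\<And>t. (P has_real_derivative P' t) (at t)" "continuous_on UNIV P'"
      "\<And>t. \<forall>\<^sub>F s in at t. P' s \<noteq> 0" "\<And>t. (P t)\<^sup>2 < 1"
    and energy: "\<And>t. (P' t * g t)\<^sup>2 = C + (P t)\<^sup>2 + (1 - \<omega>) * ln (1 - (P t)\<^sup>2)"
  shows "solves_ode \<omega> (\<lambda>x. P (\<Theta> x))"
proof -
  define \<psi> where "\<psi> x = P' (\<Theta> x) * g (\<Theta> x)" for x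
  define f where "f y = (\<omega> - y\<^sup>2) * y / (1 - y\<^sup>2)" for y :: real
  define Q where "Q y = C + y\<^sup>2 + (1 - \<omega>) * ln (1 - y\<^sup>2)" for y :: real
  have \<phi>: "((\<lambda>x. P (\<Theta> x)) has_real_derivative \<psi> x) (at x)" for x
    unfolding \<psi>_def by (rule DERIV_chain2[OF P(1) \<Theta>(1)])
  have \<Theta>cont: "isCont \<Theta> x" for x using \<Theta>(1) DERIV_isCont by blast
  have \<psi>cont: "isCont \<psi> x" for x
  proof -
    have "isCont P' t" "isCont g t" for t
      using g(1) P(2) by (auto simp: continuous_on_eq_continuous_at)
    then show ?thesis
      unfolding \<psi>_def by (intro continuous_mult isCont_o2[OF \<Theta>cont])
  qed
  have \<psi>nz: "\<forall>\<^sub>F y in at x. \<psi> y \<noteq> 0" for x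
  proof -
    \<comment> \<open>Injectivity makes \<open>\<Theta>\<close> map punctured neighbourhoods into
      punctured neighbourhoods, so the isolation of the zeros of \<open>P'\<close> pulls
      back.\<close>
    have "\<forall>\<^sub>F y in at x. \<Theta> y \<noteq> \<Theta> x"
      unfolding eventually_at using injD[OF \<Theta>(2)] by (intro exI[of _ 1]) auto
    then have "filterlim \<Theta> (at (\<Theta> x)) (at x)"
      using \<Theta>cont[of x] by (simp add: filterlim_at isCont_def)
    then have "\<forall>\<^sub>F y in at x. P' (\<Theta> y) \<noteq> 0"
      using P(3) by (rule eventually_compose_filterlim[rotated])
    then show ?thesis
    proof eventually_elim
      case (elim y)
      then show ?case using g(2)[of "\<Theta> y"] by (simp add: \<psi>_def)
    qed
  qed
  have Q: "(Q has_real_derivative 2 * f y) (at y)" if "y\<^sup>2 < 1" for y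
  proof -
    have "(Q has_real_derivative 2 * y + (1 - \<omega>) * (- (2 * y) / (1 - y\<^sup>2))) (at y)"
      using that unfolding Q_def by (auto intro!: derivative_eq_intros)
    moreover have "2 * y + (1 - \<omega>) * (- (2 * y) / (1 - y\<^sup>2)) = 2 * f y"
      using that by (simp add: f_def divide_simps) (simp add: algebra_simps)
    ultimately show ?thesis by simp
  qed
  have fcont: "isCont (\<lambda>x. f (P (\<Theta> x))) x" for x
  proof -
    have "1 - (P (\<Theta> x))\<^sup>2 \<noteq> 0" using P(4)[of "\<Theta> x"] by simp
    then show ?thesis
      unfolding f_def by (intro continuous_intros DERIV_isCont[OF \<phi>])
  qed
  have "(\<psi> has_real_derivative f (P (\<Theta> x))) (at x)" for x
  proof (rule second_order_of_first_integral[OF \<phi> \<psi>cont \<psi>nz _ _ fcont])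
    show "(\<psi> x)\<^sup>2 = Q (P (\<Theta> x))" for x
      unfolding \<psi>_def Q_def by (rule energy)
    show "(Q has_real_derivative 2 * f (P (\<Theta> x))) (at (P (\<Theta> x)))" for x
      by (rule Q[OF P(4)])
  qed
  then show ?thesis
    unfolding solves_ode_def using \<phi> P(4)[THEN less_imp_neq] by (intro exI[of _ \<psi>]) (simp add: f_def)
qed

lemma sin_zero_cases:
  assumes "sin x = 0" "0 < x" "x < 2 * pi"
  shows "x = pi"
proof -
  obtain i :: int where i: "x = of_int i * pi" using assms(1) sin_zero_iff_int2 by blast
  have "0 < (of_int i :: real)" using assms(2) i by (simp add: zero_less_mult_iff)
  moreover have "(of_int i :: real) < 2" using assms(3) i by simp
  ultimately have "i = 1" by linarith
  then show ?thesis using i by simp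
qed

section \<open>Speeds of the phase in the two families\<close>

text \<open>With \<open>W u = - u - (1 - \<omega>) * ln (1 - u)\<close> the energy equation is \<open>(\<phi>')\<^sup>2 = W m - W (\<phi>\<^sup>2)\<close>, where
  \<open>m\<close> is the maximum of \<open>\<phi>\<^sup>2\<close>. Substituting \<open>\<phi> = sqrt b * sin \<theta>\<close>, or
  \<open>\<phi>\<^sup>2 = p + (q - p) * (sin \<theta>)\<^sup>2\<close> with \<open>W p = W q\<close>, turns it into \<open>\<theta>'\<close> = speed at \<open>\<theta>\<close>, since
  \<open>W b - W u\<close> is \<open>b - u\<close> times a first divided difference of \<open>W\<close>, and \<open>W q - W u\<close> is
  \<open>(q - u) * (u - p)\<close> times a second one.\<close>

definition odd_speed :: "real \<Rightarrow> real \<Rightarrow> real \<Rightarrow> real" where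
  "odd_speed \<omega> b t = sqrt ((1 - \<omega>) * log_dd2 b (b * (sin t)\<^sup>2) - 1)"

definition even_speed :: "real \<Rightarrow> real \<Rightarrow> real \<Rightarrow> real \<Rightarrow> real" where
  "even_speed \<omega> p q t = (let u = p + (q - p) * (sin t)\<^sup>2 in sqrt (u * ((1 - \<omega>) * log_dd3 p q u)))"

lemma mult_sin_squared_bounds:
  fixes b :: real
  assumes "0 \<le> b"
  shows "0 \<le> b * (sin t)\<^sup>2" "b * (sin t)\<^sup>2 \<le> b"
  using assms by (simp_all add: mult_left_le power_le_one_iff abs_square_le_1)

text \<open>The last assumption says \<open>W b > W 0\<close>: the orbit has enough energy to cross
  the origin. Since \<open>log_dd2\<close> increases in its nodes, the phase is slowest at
  \<open>sin t = 0\<close>.\<close>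

lemma odd_speed_pos:
  assumes "0 < b" "b < 1" "\<omega> < 1" "1 < (1 - \<omega>) * log_dd2 b 0"
  shows "0 < odd_speed \<omega> b t"
proof -
  have "(1 - \<omega>) * log_dd2 b 0 \<le> (1 - \<omega>) * log_dd2 b (b * (sin t)\<^sup>2)"
    using assms(1-3) mult_sin_squared_bounds[of b t] by (intro mult_left_mono log_dd2_mono) linarith+
  then show ?thesis using assms(4) unfolding odd_speed_def by simp
qed

text \<open>The factor \<open>(1 - \<omega>) * log_dd3 p q u\<close> is a second divided difference
  of \<open>W\<close>, the linear term having dropped out, so strict convexity makes it
  positive.\<close>

lemma even_speed_pos:
  assumes "0 < p" "p < q" "q < 1" "\<omega> < 1"
  shows "0 < even_speed \<omega> p q t"
proof -
  define u where "u = p + (q - p) * (sin t)\<^sup>2"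
  have u: "p \<le> u" "u \<le> q"
    using assms mult_sin_squared_bounds[of "q - p" t] unfolding u_def by linarith+
  have "0 < log_dd3 p q u" using assms u by (intro log_dd3_pos) auto
  then show ?thesis using assms u by (simp add: even_speed_def Let_def flip: u_def)
qed

lemma continuous_on_odd_speed:
  assumes "\<And>b. b \<in> S \<Longrightarrow> 0 < b \<and> b < 1"
  shows "continuous_on (S \<times> R) (\<lambda>(b, t). odd_speed \<omega> b t)"
proof -
  have "b * (sin t)\<^sup>2 < 1" if "b \<in> S" for b t
    using assms[OF that] mult_sin_squared_bounds[of b t] by linarith
  then show ?thesis
    using assms unfolding odd_speed_def case_prod_beta by (intro continuous_intros) auto
qed

lemma continuous_on_even_speed:
  fixes S :: "real set"
  assumes "continuous_on S p" "continuous_on S q" "\<And>z. z \<in> S \<Longrightarrow> p z < q z \<and> q z < 1"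
  shows "continuous_on (S \<times> R) (\<lambda>(z, t). even_speed \<omega> (p z) (q z) t)"
proof -
  have "p z + (q z - p z) * (sin t)\<^sup>2 < 1" if "z \<in> S" for z t
    using assms(3)[OF that] mult_sin_squared_bounds[of "q z - p z" t] by linarith
  moreover have "p z < 1" if "z \<in> S" for z using assms(3)[OF that] by linarith
  moreover have "continuous_on (S \<times> R) (\<lambda>x. p (fst x))" "continuous_on (S \<times> R) (\<lambda>x. q (fst x))"
    by (auto intro!: continuous_on_compose2[OF assms(1)] continuous_on_compose2[OF assms(2)] continuous_intros)
  ultimately show ?thesis
    using assms(3) unfolding even_speed_def Let_def case_prod_beta
    by (intro continuous_intros) auto
qed

section \<open>Orbits with prescribed turning values\<close>

text \<open>The profile needs a full turn of the sine. A phase gain of \<open>pi\<close> only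
  reverses its sign, hence the factor 2 in \<open>L\<close> and the reflection about the quarter
  period.\<close>

lemma odd_orbit_exists:
  fixes \<omega> b x0 :: real
  assumes b: "0 < b" "b < 1" and \<omega>: "\<omega> < 1" and E: "1 < (1 - \<omega>) * log_dd2 b 0"
  defines "L \<equiv> 2 * integral {0..pi} (\<lambda>t. 1 / odd_speed \<omega> b t)"
  shows "\<exists>\<phi>. periodic_orbit \<omega> L \<phi> \<and> smooth \<phi> \<and>
    (\<forall>x. -1 < \<phi> x \<and> \<phi> x < 1 \<and> \<phi> (x0 + x) = - \<phi> (x0 - x) \<and> - \<phi> (x0 - x) = \<phi> (x0 + L / 2 - x))"
proof -
  let ?g = "odd_speed \<omega> b"
  define T where "T = integral {0..pi} (\<lambda>t. 1 / odd_speed \<omega> b t)"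
  have gpos: "0 < ?g t" for t by (rule odd_speed_pos[OF b \<omega> E])
  \<comment> \<open>Continuity in \<open>t\<close> alone is joint continuity over the one-point
    parameter set \<open>{b}\<close>.\<close>
  have "continuous_on UNIV (\<lambda>t. case (b, t) of (b, t) \<Rightarrow> odd_speed \<omega> b t)"
    by (rule continuous_on_compose2[OF continuous_on_odd_speed[of "{b}" UNIV \<omega>]])
      (use b in \<open>auto intro!: continuous_intros\<close>)
  then have gcont: "continuous_on UNIV ?g" by simp
  obtain \<Theta> where \<Theta>: "\<And>x. (\<Theta> has_real_derivative ?g (\<Theta> x)) (at x)" "strict_mono \<Theta>"
    "\<Theta> 0 = 0" "\<And>x. \<Theta> (- x) = - \<Theta> x" "\<And>x. \<Theta> (x + T) = \<Theta> x + pi" "0 < T"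
    using periodic_flow[OF gcont gpos pi_gt_zero] unfolding T_def by (auto simp: odd_speed_def)
  define \<phi> where "\<phi> x = sqrt b * sin (\<Theta> (x - x0))" for x
  have L: "L = 2 * T" by (simp add: L_def T_def)
  have usq: "b * (sin t)\<^sup>2 < 1" for t using mult_sin_squared_bounds[of b t] b by linarith
  have sol: "solves_ode \<omega> \<phi>"
    unfolding \<phi>_def
  proof (rule solves_ode_of_phase[where P = "\<lambda>t. sqrt b * sin t" and P' = "\<lambda>t. sqrt b * cos t"
        and C = "- b - (1 - \<omega>) * ln (1 - b)"])
    show "((\<lambda>x. \<Theta> (x - x0)) has_real_derivative ?g (\<Theta> (x - x0))) (at x)" for x
      by (rule DERIV_cong[OF DERIV_chain2[OF \<Theta>(1)]]) (auto intro!: derivative_eq_intros)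
    show "inj (\<lambda>x. \<Theta> (x - x0))"
      using \<Theta>(2) by (auto simp: inj_def strict_mono_eq)
    show "\<forall>\<^sub>F s in at t. sqrt b * cos s \<noteq> 0" for t
    proof (rule eventually_nonzero_of_simple_zeros)
      show "((\<lambda>s. sqrt b * cos s) has_real_derivative - sqrt b * sin t) (at t)"
        by (auto intro!: derivative_eq_intros)
      show "- sqrt b * sin t \<noteq> 0" if "sqrt b * cos t = 0"
        using that b sin_cos_squared_add[of t] by auto
    qed
    show "(sqrt b * sin t)\<^sup>2 < 1" for t using usq[of t] b by (simp add: power_mult_distrib)
    show "(sqrt b * cos t * ?g t)\<^sup>2 = - b - (1 - \<omega>) * ln (1 - b) + (sqrt b * sin t)\<^sup>2 +
        (1 - \<omega>) * ln (1 - (sqrt b * sin t)\<^sup>2)" for t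
    proof -
      define u where "u = b * (sin t)\<^sup>2"
      have c: "b * (cos t)\<^sup>2 = b - u" by (simp add: u_def cos_squared_eq algebra_simps)
      have "0 \<le> (1 - \<omega>) * log_dd2 b u - 1"
        using gpos[of t] by (simp add: odd_speed_def u_def)
      then have "(sqrt b * cos t * ?g t)\<^sup>2 = (b - u) * ((1 - \<omega>) * log_dd2 b u - 1)"
        using b by (simp add: power_mult_distrib c odd_speed_def flip: u_def)
      also have "\<dots> = (1 - \<omega>) * ((b - u) * log_dd2 b u) - (b - u)" by algebra
      also have "\<dots> = (1 - \<omega>) * (ln (1 - u) - ln (1 - b)) - (b - u)"
        using log_dd2_eq[of b u] b usq[of t] by (simp add: u_def)
      finally show ?thesis using b by (simp add: power_mult_distrib algebra_simps flip: u_def)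
    qed
  qed (auto intro!: derivative_eq_intros continuous_intros gcont gpos)
  have "\<bar>\<phi> x\<bar> < 1" for x
  proof -
    have "(\<phi> x)\<^sup>2 < 1" using usq[of "\<Theta> (x - x0)"] b by (simp add: \<phi>_def power_mult_distrib)
    then show ?thesis by (simp add: abs_square_less_1)
  qed
  then have bounds: "-1 < \<phi> x \<and> \<phi> x < 1" for x by (simp add: abs_less_iff)
  have half: "\<phi> (x + T) = - \<phi> x" for x
    using \<Theta>(5)[of "x - x0"] by (simp add: \<phi>_def algebra_simps)
  have odd: "\<phi> (x0 + x) = - \<phi> (x0 - x)" for x
    using \<Theta>(4)[of x] by (simp add: \<phi>_def)
  have refl: "- \<phi> (x0 - x) = \<phi> (x0 + L / 2 - x)" for x
    using half[of "x0 - x"] by (simp add: L algebra_simps)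
  have per: "\<phi> (x + L) = \<phi> x" for x
    using half[of x] half[of "x + T"] by (simp add: L algebra_simps)
  have \<Theta>T: "\<Theta> T = pi" using \<Theta>(5)[of 0] \<Theta>(3) by simp
  have \<Theta>L: "\<Theta> L = 2 * pi" using \<Theta>(5)[of T] \<Theta>T by (simp add: L)
  \<comment> \<open>A smaller period \<open>S\<close> would put a zero of the sine at the phase
    \<open>\<Theta> S\<close> strictly between 0 and \<open>2 * pi\<close>, so \<open>S = T\<close>.
    But shifting by \<open>T\<close> reverses the sign, which would force
    \<open>\<phi> = 0\<close>.\<close>
  have min: "\<not> (\<forall>x. \<phi> (x + S) = \<phi> x)" if S: "0 < S" "S < L" for S
  proof
    assume H: "\<forall>x. \<phi> (x + S) = \<phi> x"
    have "0 < \<Theta> S" "\<Theta> S < 2 * pi"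
      using strict_monoD[OF \<Theta>(2) S(1)] strict_monoD[OF \<Theta>(2) S(2)] \<Theta>(3) \<Theta>L by auto
    moreover have "sin (\<Theta> S) = 0" using H[rule_format, of x0] b \<Theta>(3) by (simp add: \<phi>_def)
    ultimately have "\<Theta> S = pi" by (intro sin_zero_cases)
    then have "S = T" using \<Theta>T \<Theta>(2) by (metis strict_mono_eq)
    then have "\<phi> x = 0" for x using half[of x] H by simp
    from this[of "x0 + T / 2"] have "sin (\<Theta> (T / 2)) = 0" using b by (simp add: \<phi>_def)
    moreover have "0 < \<Theta> (T / 2)" "\<Theta> (T / 2) < pi"
      using strict_monoD[OF \<Theta>(2), of 0 "T / 2"] strict_monoD[OF \<Theta>(2), of "T / 2" T] \<Theta>(3,6) \<Theta>T by auto
    ultimately show False using sin_gt_zero[of "\<Theta> (T / 2)"] by simp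
  qed
  have Lpos: "0 < L" using \<Theta>(6) L by simp
  have "\<not> \<phi> constant_on UNIV"
    using min[of "L / 2"] Lpos unfolding constant_on_def by (metis UNIV_I half_gt_zero field_sum_of_halves less_add_same_cancel1)
  then have "periodic_orbit \<omega> L \<phi>"
    using sol Lpos per min by (auto simp: periodic_orbit_def has_fundamental_period_def)
  then show ?thesis using smooth_if_solves_ode[OF sol] bounds odd refl by blast
qed

text \<open>Assumption \<open>E\<close> is \<open>W p = W q\<close>: both are turning values at the
  same energy. As \<open>\<phi>\<close> depends on the phase through \<open>(sin t)\<^sup>2\<close>,
  one period is a phase gain of \<open>pi\<close> only.\<close>

lemma even_orbit_exists:
  fixes \<omega> p q x0 :: real
  assumes pq: "0 < p" "p < q" "q < 1" and \<omega>: "\<omega> < 1" and E: "(1 - \<omega>) * log_dd2 q p = 1"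
  defines "L \<equiv> integral {0..pi} (\<lambda>t. 1 / even_speed \<omega> p q t)"
  shows "\<exists>\<phi>. periodic_orbit \<omega> L \<phi> \<and> smooth \<phi> \<and>
    (\<forall>x. 0 < \<phi> x \<and> \<phi> x < 1 \<and> \<phi> (x0 + x) = \<phi> (x0 - x))"
proof -
  let ?g = "even_speed \<omega> p q"
  have gpos: "0 < ?g t" for t by (rule even_speed_pos[OF pq \<omega>])
  have "continuous_on UNIV (\<lambda>t. case (0 :: real, t) of (z, t) \<Rightarrow> even_speed \<omega> p q t)"
    by (rule continuous_on_compose2[OF continuous_on_even_speed[of "{0}" "\<lambda>z. p" "\<lambda>z. q" UNIV \<omega>]])
      (use pq in \<open>auto intro!: continuous_intros\<close>)
  then have gcont: "continuous_on UNIV ?g" by simp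
  obtain \<Theta> where \<Theta>: "\<And>x. (\<Theta> has_real_derivative ?g (\<Theta> x)) (at x)" "strict_mono \<Theta>"
    "\<Theta> 0 = 0" "\<And>x. \<Theta> (- x) = - \<Theta> x" "\<And>x. \<Theta> (x + L) = \<Theta> x + pi" "0 < L"
    using periodic_flow[OF gcont gpos pi_gt_zero] unfolding L_def by (auto simp: even_speed_def)
  define u where "u t = p + (q - p) * (sin t)\<^sup>2" for t
  have u: "p \<le> u t" "u t \<le> q" for t
    using pq mult_sin_squared_bounds[of "q - p" t] unfolding u_def by linarith+
  have u': "0 < u t" "u t < 1" for t using u[of t] pq by linarith+
  have uder: "(u has_real_derivative (q - p) * (2 * sin t * cos t)) (at t)" for t
    unfolding u_def by (auto intro!: derivative_eq_intros)
  have ucont: "continuous_on UNIV u"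
    unfolding u_def by (intro continuous_intros)
  define \<phi> where "\<phi> x = sqrt (u (\<Theta> (x - x0)))" for x
  have sol: "solves_ode \<omega> \<phi>"
    unfolding \<phi>_def
  proof (rule solves_ode_of_phase[where P = "\<lambda>t. sqrt (u t)" and P' = "\<lambda>t. (q - p) * (sin t * cos t) / sqrt (u t)"
        and C = "- q - (1 - \<omega>) * ln (1 - q)"])
    show "((\<lambda>x. \<Theta> (x - x0)) has_real_derivative ?g (\<Theta> (x - x0))) (at x)" for x
      by (rule DERIV_cong[OF DERIV_chain2[OF \<Theta>(1)]]) (auto intro!: derivative_eq_intros)
    show "inj (\<lambda>x. \<Theta> (x - x0))"
      using \<Theta>(2) by (auto simp: inj_def strict_mono_eq)
    show "((\<lambda>t. sqrt (u t)) has_real_derivative (q - p) * (sin t * cos t) / sqrt (u t)) (at t)" for t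
      using u'(1)[of t] by (auto intro!: derivative_eq_intros uder simp: field_simps)
    show "continuous_on UNIV (\<lambda>t. (q - p) * (sin t * cos t) / sqrt (u t))"
      using u'(1) by (intro continuous_intros ucont) (auto simp: less_imp_neq[symmetric])
    show "\<forall>\<^sub>F s in at t. (q - p) * (sin s * cos s) / sqrt (u s) \<noteq> 0" for t
    proof -
      have "\<forall>\<^sub>F s in at t. sin s * cos s \<noteq> 0"
      proof (rule eventually_nonzero_of_simple_zeros)
        show "((\<lambda>s. sin s * cos s) has_real_derivative (cos t)\<^sup>2 - (sin t)\<^sup>2) (at t)"
          by (auto intro!: derivative_eq_intros simp: power2_eq_square)
        show "(cos t)\<^sup>2 - (sin t)\<^sup>2 \<noteq> 0" if "sin t * cos t = 0"
          using that sin_cos_squared_add[of t] by (auto simp del: sin_cos_squared_add)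
      qed
      then show ?thesis
      proof eventually_elim
        case (elim s)
        then show ?case using u'(1)[of s] pq by auto
      qed
    qed
    show "(sqrt (u t))\<^sup>2 < 1" for t using u'[of t] by simp
    show "((q - p) * (sin t * cos t) / sqrt (u t) * ?g t)\<^sup>2 = - q - (1 - \<omega>) * ln (1 - q) + (sqrt (u t))\<^sup>2 +
        (1 - \<omega>) * ln (1 - (sqrt (u t))\<^sup>2)" for t
    proof -
      let ?K = "log_dd3 p q (u t)"
      have c: "(q - p) * (cos t)\<^sup>2 = q - u t" "(q - p) * (sin t)\<^sup>2 = u t - p"
        by (simp_all add: u_def cos_squared_eq algebra_simps)
      have g: "?g t = sqrt (u t * ((1 - \<omega>) * ?K))" by (simp add: even_speed_def Let_def u_def)
      have g2: "(?g t)\<^sup>2 = u t * ((1 - \<omega>) * ?K)"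
        using gpos[of t] unfolding g by (intro real_sqrt_pow2) auto
      have "((q - p) * (sin t * cos t) / sqrt (u t) * ?g t)\<^sup>2 =
          ((q - p) * (sin t * cos t))\<^sup>2 / (sqrt (u t))\<^sup>2 * (?g t)\<^sup>2"
        by (simp add: power_mult_distrib power_divide)
      also have "\<dots> = ((q - p) * (sin t * cos t))\<^sup>2 * ((1 - \<omega>) * ?K)"
        using u'(1)[of t] unfolding g2 by simp
      also have "((q - p) * (sin t * cos t))\<^sup>2 = ((q - p) * (cos t)\<^sup>2) * ((q - p) * (sin t)\<^sup>2)"
        by algebra
      also have "\<dots> * ((1 - \<omega>) * ?K) = (q - u t) * (1 - \<omega>) * ((u t - p) * ?K)"
        unfolding c by algebra
      also have "(u t - p) * ?K = log_dd2 q (u t) - log_dd2 q p"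
        using pq u'[of t] by (intro log_dd3_eq) auto
      also have "(q - u t) * (1 - \<omega>) * (log_dd2 q (u t) - log_dd2 q p) =
          (1 - \<omega>) * ((q - u t) * log_dd2 q (u t)) - (q - u t) * ((1 - \<omega>) * log_dd2 q p)"
        by algebra
      also have "\<dots> = (1 - \<omega>) * (ln (1 - u t) - ln (1 - q)) - (q - u t)"
        unfolding E using log_dd2_eq[of q "u t"] pq u'[of t] by simp
      finally show ?thesis using u'(1)[of t] by (simp add: algebra_simps)
    qed
  qed (use gcont gpos in auto)
  have bounds: "0 < \<phi> x \<and> \<phi> x < 1" for x
    using u'[of "\<Theta> (x - x0)"] by (simp add: \<phi>_def)
  have even: "\<phi> (x0 + x) = \<phi> (x0 - x)" for x
    using \<Theta>(4)[of x] by (simp add: \<phi>_def u_def)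
  have per: "\<phi> (x + L) = \<phi> x" for x
    using \<Theta>(5)[of "x - x0"] by (simp add: \<phi>_def u_def algebra_simps)
  have \<Theta>L: "\<Theta> L = pi" using \<Theta>(5)[of 0] \<Theta>(3) by simp
  \<comment> \<open>The minimum \<open>sqrt p\<close> is attained at \<open>x0\<close> and recurs
    only where the sine of the phase vanishes again.\<close>
  have min: "\<not> (\<forall>x. \<phi> (x + S) = \<phi> x)" if S: "0 < S" "S < L" for S
  proof
    assume "\<forall>x. \<phi> (x + S) = \<phi> x"
    then have "\<phi> (x0 + S) = \<phi> x0" by blast
    then have "sin (\<Theta> S) = 0" using pq \<Theta>(3) by (simp add: \<phi>_def u_def)
    moreover have "0 < \<Theta> S" "\<Theta> S < pi"
      using strict_monoD[OF \<Theta>(2) S(1)] strict_monoD[OF \<Theta>(2) S(2)] \<Theta>(3) \<Theta>L by auto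
    ultimately show False using sin_gt_zero[of "\<Theta> S"] by simp
  qed
  have "\<not> \<phi> constant_on UNIV"
    using min[of "L / 2"] \<Theta>(6) unfolding constant_on_def by (metis UNIV_I half_gt_zero field_sum_of_halves less_add_same_cancel1)
  then have "periodic_orbit \<omega> L \<phi>"
    using sol \<Theta>(6) per min by (auto simp: periodic_orbit_def has_fundamental_period_def)
  then show ?thesis using smooth_if_solves_ode[OF sol] bounds even by blast
qed

section \<open>Intermediate values and the periods of odd orbits\<close>

text \<open>Connectedness serves parameter sets that may be open, with the parameters of the short
  and the long period in either order.\<close>

lemma intermediate_value_interval:
  fixes f :: "real \<Rightarrow> real"
  assumes "is_interval S" "continuous_on S f" "a \<in> S" "b \<in> S" "f a \<le> y" "y \<le> f b"
  obtains x where "x \<in> S" "f x = y"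
proof -
  have "connected (f ` S)"
    by (rule connected_continuous_image[OF assms(2) is_interval_connected[OF assms(1)]])
  then have "y \<in> f ` S"
    using assms(3-6) by (rule connectedD_interval[OF _ imageI imageI])
  then show ?thesis using that by blast
qed

lemma log_dd2_zero_gt_one:
  assumes "0 < b" "b < 1"
  shows "1 < log_dd2 b 0"
proof -
  have "1 - b < exp (- b)" using exp_minus_greater[of b] assms by simp
  then have "ln (1 - b) < - b" using assms by (metis diff_gt_0_iff_gt ln_exp ln_less_cancel_iff exp_gt_zero)
  moreover have "b * log_dd2 b 0 = - ln (1 - b)" using log_dd2_eq[of b 0] assms by simp
  ultimately have "b * 1 < b * log_dd2 b 0" by simp
  then show ?thesis using assms by simp
qed

text \<open>The logarithmic blow-up as \<open>b\<close> tends to 1 drives the speed to infinity and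
  so supplies arbitrarily short periods.\<close>

lemma log_dd2_zero_ge_ln:
  assumes "0 < b" "b < 1"
  shows "- ln (1 - b) \<le> log_dd2 b 0"
proof -
  have "b * log_dd2 b 0 \<le> 1 * log_dd2 b 0"
    using assms log_dd2_zero_gt_one[OF assms] by (intro mult_right_mono) auto
  then show ?thesis using log_dd2_eq[of b 0] assms by simp
qed

lemma odd_period_attained:
  assumes L: "0 < L" and \<omega>: "Omega_lower L < \<omega>" "\<omega> < 1"
  obtains b where "0 < b" "b < 1" "1 < (1 - \<omega>) * log_dd2 b 0"
    "2 * integral {0..pi} (\<lambda>t. 1 / odd_speed \<omega> b t) = L"
proof -
  \<comment> \<open>\<open>E b = (W b - W 0) / b\<close> is also the squared speed at phase 0, the
    minimal one; \<open>B\<close> collects the amplitudes whose orbits cross the origin.\<close>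
  define E where "E b = (1 - \<omega>) * log_dd2 b 0 - 1" for b
  define B where "B = {b. 0 < b \<and> b < 1 \<and> 0 < E b}"
  define T where "T b = 2 * integral {0..pi} (\<lambda>t. 1 / odd_speed \<omega> b t)" for b
  have Emono: "E a \<le> E b" if "a \<le> b" "b < 1" for a b
    using that \<omega> log_dd2_mono[of a b 0 0] by (simp add: E_def)
  have int: "is_interval B"
    unfolding is_interval_1 B_def using Emono by (auto intro: less_le_trans)
  have pos: "0 < odd_speed \<omega> b t" if "b \<in> B" for b t
    using that \<omega> by (intro odd_speed_pos) (auto simp: B_def E_def)
  have jcont: "continuous_on (B \<times> {0..pi}) (\<lambda>(b, t). odd_speed \<omega> b t)"
    by (rule continuous_on_odd_speed) (simp add: B_def)
  have scont: "continuous_on {0..pi} (odd_speed \<omega> b)" if "b \<in> B" for b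
  proof -
    have "continuous_on {0..pi} (\<lambda>t. case (b, t) of (b, t) \<Rightarrow> odd_speed \<omega> b t)"
      by (rule continuous_on_compose2[OF jcont]) (use that in \<open>auto intro!: continuous_intros\<close>)
    then show ?thesis by simp
  qed
  have Tcont: "continuous_on B T"
    unfolding T_def by (intro continuous_intros continuous_on_integral_inverse jcont pos)
  have speed_le: "odd_speed \<omega> b t \<le> c" if "b \<in> B" "0 \<le> c" "(1 - \<omega>) * log_dd2 b (b * (sin t)\<^sup>2) - 1 \<le> c\<^sup>2" for b t c
    unfolding odd_speed_def using that by (intro real_le_lsqrt)
  obtain b1 where b1: "b1 \<in> B" "4 * pi\<^sup>2 / L\<^sup>2 \<le> E b1"
  proof -
    \<comment> \<open>At \<open>b = 1 - exp (- c)\<close> the bound \<open>- ln (1 - b)\<close>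
      equals \<open>c\<close>. The choice of \<open>c\<close> makes \<open>E b\<close> at least
      \<open>4 * pi\<^sup>2 / L\<^sup>2 + 1\<close>, which is positive and forces speeds above
      \<open>2 * pi / L\<close>.\<close>
    define c where "c = (4 * pi\<^sup>2 / L\<^sup>2 + 2) / (1 - \<omega>)"
    have c: "0 < c" using \<omega> by (simp add: c_def add_nonneg_pos)
    have c': "(1 - \<omega>) * c = 4 * pi\<^sup>2 / L\<^sup>2 + 2" using \<omega> by (simp add: c_def)
    have "(1 - \<omega>) * c \<le> (1 - \<omega>) * log_dd2 (1 - exp (- c)) 0"
      using log_dd2_zero_ge_ln[of "1 - exp (- c)"] c \<omega> by (intro mult_left_mono) auto
    then have "4 * pi\<^sup>2 / L\<^sup>2 + 1 \<le> E (1 - exp (- c))"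
      unfolding E_def c' by linarith
    moreover from this have "0 < E (1 - exp (- c))"
      by (rule less_le_trans[rotated]) (simp add: add_nonneg_pos)
    ultimately show ?thesis using c by (intro that[of "1 - exp (- c)"]) (auto simp: B_def)
  qed
  have T1: "T b1 \<le> L"
  proof -
    have bb: "0 < b1" "b1 < 1" "0 < E b1" using b1 by (auto simp: B_def)
    have "2 * pi / L \<le> odd_speed \<omega> b1 t" for t
      unfolding odd_speed_def
    proof (rule real_le_rsqrt)
      have "(1 - \<omega>) * log_dd2 b1 0 \<le> (1 - \<omega>) * log_dd2 b1 (b1 * (sin t)\<^sup>2)"
        using bb \<omega> mult_sin_squared_bounds[of b1 t] by (intro mult_left_mono log_dd2_mono) linarith+
      then show "(2 * pi / L)\<^sup>2 \<le> (1 - \<omega>) * log_dd2 b1 (b1 * (sin t)\<^sup>2) - 1"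
        using b1(2) by (simp add: E_def power_divide power_mult_distrib)
    qed
    then have "integral {0..pi} (\<lambda>t. 1 / odd_speed \<omega> b1 t) \<le> pi / (2 * pi / L)"
      using L by (intro integral_inverse_le scont b1) auto
    then show ?thesis using L by (simp add: T_def)
  qed
  obtain b2 where b2: "b2 \<in> B" "L \<le> T b2"
  proof (cases "\<omega> \<le> 0")
    case True
    \<comment> \<open>A speed of at most \<open>2 * pi / L\<close> gives a period of at least
      \<open>L\<close>. As \<open>b\<close> tends to 0 the largest squared speed
      \<open>(1 - \<omega>) / (1 - b) - 1\<close> tends to \<open>- \<omega>\<close>, which is below
      \<open>c\<^sup>2\<close> because \<open>\<omega> > Omega_lower L\<close>.\<close>
    define c where "c = 2 * pi / L"
    have c: "0 < c" "0 - \<omega> < c\<^sup>2"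
      using L \<omega> by (auto simp: c_def Omega_lower_def power_divide power_mult_distrib)
    have "((\<lambda>b. (1 - \<omega>) / (1 - b) - 1) \<longlongrightarrow> (1 - \<omega>) / (1 - 0) - 1) (at_right 0)"
      by (intro tendsto_intros) auto
    then have "\<forall>\<^sub>F b in at_right 0. (1 - \<omega>) / (1 - b) - 1 < c\<^sup>2"
      using c by (intro order_tendstoD(2)) auto
    moreover have "\<forall>\<^sub>F b in at_right 0. b \<in> {0<..<1::real}"
      by (rule eventually_at_right_real) simp
    ultimately have "\<forall>\<^sub>F b in at_right 0. 0 < b \<and> b < 1 \<and> (1 - \<omega>) / (1 - b) - 1 < c\<^sup>2"
      by eventually_elim auto
    then obtain b where b: "0 < b" "b < 1" "(1 - \<omega>) / (1 - b) - 1 < c\<^sup>2"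
      using eventually_happens'[OF trivial_limit_at_right_real] by blast
    have "1 * log_dd2 b 0 \<le> (1 - \<omega>) * log_dd2 b 0"
      using True log_dd2_zero_gt_one[OF b(1,2)] by (intro mult_right_mono) auto
    then have "0 < E b" unfolding E_def using log_dd2_zero_gt_one[OF b(1,2)] by linarith
    then have bB: "b \<in> B" using b by (simp add: B_def)
    have "odd_speed \<omega> b t \<le> c" for t
    proof (rule speed_le[OF bB])
      have "(1 - \<omega>) * log_dd2 b (b * (sin t)\<^sup>2) \<le> (1 - \<omega>) * log_dd2 b b"
        using b \<omega> mult_sin_squared_bounds[of b t] by (intro mult_left_mono log_dd2_mono) linarith+
      then show "(1 - \<omega>) * log_dd2 b (b * (sin t)\<^sup>2) - 1 \<le> c\<^sup>2"
        using b(3) log_dd2_diag[OF b(2)] by simp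
    qed (use c in simp)
    then have "pi / c \<le> integral {0..pi} (\<lambda>t. 1 / odd_speed \<omega> b t)"
      by (intro integral_inverse_ge scont pos bB) auto
    then have "L \<le> T b" using L by (simp add: T_def c_def)
    then show ?thesis using that bB by blast
  next
    case False
    have bb: "0 < b1" "b1 < 1" "0 < E b1" using b1 by (auto simp: B_def)
    \<comment> \<open>Now the origin is a saddle. All amplitudes below stay under \<open>b1\<close>,
      so evaluating \<open>log_dd3\<close> there makes \<open>C\<close> independent of
      \<open>\<epsilon>\<close>.\<close>
    define C where "C = sqrt ((1 - \<omega>) / (2 * (1 - b1)\<^sup>2))"
    have Csq: "C\<^sup>2 = (1 - \<omega>) / (2 * (1 - b1)\<^sup>2)" using \<omega> by (simp add: C_def)
    have Cpos: "0 < C" using \<omega> bb by (simp add: C_def)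
    have "filterlim (\<lambda>\<epsilon>. 2 * (ln (1 + C * pi / \<epsilon>) / C)) at_top (at_right 0)"
      using Cpos by real_asymp
    then have "\<forall>\<^sub>F \<epsilon> in at_right 0. L \<le> 2 * (ln (1 + C * pi / \<epsilon>) / C)"
      by (simp add: filterlim_at_top)
    moreover have "\<forall>\<^sub>F \<epsilon> in at_right 0. \<epsilon> \<in> {0<..<sqrt (E b1)}"
      by (rule eventually_at_right_real) (use bb in simp)
    ultimately have "\<forall>\<^sub>F \<epsilon> in at_right 0. 0 < \<epsilon> \<and> \<epsilon> < sqrt (E b1) \<and> L \<le> 2 * (ln (1 + C * pi / \<epsilon>) / C)"
      by eventually_elim auto
    then obtain \<epsilon> where \<epsilon>: "0 < \<epsilon>" "\<epsilon> < sqrt (E b1)" "L \<le> 2 * (ln (1 + C * pi / \<epsilon>) / C)"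
      using eventually_happens'[OF trivial_limit_at_right_real] by blast
    have \<epsilon>2: "\<epsilon>\<^sup>2 \<le> E b1" using \<epsilon> bb by (metis less_imp_le real_le_rsqrt power_mono real_sqrt_pow2)
    have Econt: "continuous_on {0..b1} E"
      unfolding E_def using bb by (intro continuous_intros) auto
    have E0: "E 0 = - \<omega>" by (simp add: E_def log_dd2_diag)
    \<comment> \<open>\<open>E\<close> is negative at 0, so some amplitude has speed exactly
      \<open>\<epsilon>\<close> at phase 0; small \<open>\<epsilon>\<close> means close to the
      homoclinic orbit.\<close>
    have "E 0 \<le> \<epsilon>\<^sup>2" unfolding E0 using False zero_le_power2[of \<epsilon>] by linarith
    then obtain b where b: "0 \<le> b" "b \<le> b1" "E b = \<epsilon>\<^sup>2"
      using IVT'[of E 0 "\<epsilon>\<^sup>2" b1] \<epsilon>2 bb Econt by auto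
    have "b \<noteq> 0"
    proof
      assume "b = 0"
      then have "\<epsilon>\<^sup>2 = - \<omega>" using b(3) E0 by simp
      then show False using False zero_le_power2[of \<epsilon>] by linarith
    qed
    then have b': "0 < b" "b < 1" using b bb by auto
    have bB: "b \<in> B" using b b' \<epsilon> by (simp add: B_def)
    have "odd_speed \<omega> b t \<le> \<epsilon> + C * t" if "t \<in> {0..pi}" for t
    proof (rule speed_le[OF bB])
      define u where "u = b * (sin t)\<^sup>2"
      have u: "0 \<le> u" "u \<le> b" using mult_sin_squared_bounds[of b t] b' by (auto simp: u_def)
      have "u \<le> 1 * t\<^sup>2"
        unfolding u_def using b' abs_sin_x_le_abs_x[of t] by (intro mult_mono) (auto simp: abs_le_square_iff)
      \<comment> \<open>The excess of the squared speed over its value at phase 0 is of first order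
        in \<open>u\<close>, hence of second order in \<open>t\<close>.\<close>
      have "log_dd2 b u - log_dd2 b 0 = u * log_dd3 0 b u"
        using log_dd3_eq[of 0 b u] b' u by simp
      also have "\<dots> \<le> u * log_dd3 b1 b1 b1"
        using b b' bb u by (intro mult_left_mono log_dd3_mono) auto
      also have "\<dots> \<le> t\<^sup>2 * (1 / (2 * (1 - b1)\<^sup>2))"
        unfolding log_dd3_diag[OF bb(2)] using \<open>u \<le> 1 * t\<^sup>2\<close> by (intro mult_right_mono) auto
      finally have "(1 - \<omega>) * (log_dd2 b u - log_dd2 b 0) \<le> (1 - \<omega>) * (t\<^sup>2 * (1 / (2 * (1 - b1)\<^sup>2)))"
        using \<omega> by (intro mult_left_mono) auto
      also have "\<dots> = C\<^sup>2 * t\<^sup>2" unfolding Csq by simp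
      finally have "(1 - \<omega>) * log_dd2 b u - 1 \<le> \<epsilon>\<^sup>2 + C\<^sup>2 * t\<^sup>2"
        using b(3) by (simp add: E_def algebra_simps)
      also have "\<dots> \<le> (\<epsilon> + C * t)\<^sup>2"
        using \<epsilon> Cpos that by (simp add: power2_sum power_mult_distrib)
      finally show "(1 - \<omega>) * log_dd2 b (b * (sin t)\<^sup>2) - 1 \<le> (\<epsilon> + C * t)\<^sup>2" by (simp add: u_def)
    qed (use \<epsilon> Cpos that in auto)
    then have "ln (1 + C * pi / \<epsilon>) / C \<le> integral {0..pi} (\<lambda>t. 1 / odd_speed \<omega> b t)"
      using \<epsilon> Cpos by (intro integral_inverse_ge_ln scont pos bB) auto
    then have "L \<le> T b" using \<epsilon>(3) by (simp add: T_def)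
    then show ?thesis using that bB by blast
  qed
  obtain b where "b \<in> B" "T b = L"
    using intermediate_value_interval[OF int Tcont b1(1) b2(1) T1 b2(2)] by blast
  then show ?thesis using that by (auto simp: B_def E_def T_def)
qed

section \<open>Positive orbits: turning values and periods\<close>

text \<open>The generating function of the Bernoulli numbers. It arises from solving
  \<open>(1 - p) * (1 - exp (- z)) = (1 - \<omega>) * z\<close> for \<open>1 - p\<close>; the left
  side is \<open>q - p\<close> when \<open>1 - q = (1 - p) * exp (- z)\<close>.\<close>

definition bernoulli_fun :: "real \<Rightarrow> real" where
  "bernoulli_fun z = z / (1 - exp (- z))"

lemma bernoulli_fun_bounds:
  assumes "0 < z"
  shows "1 < bernoulli_fun z" "z < bernoulli_fun z"
    "bernoulli_fun z - z = bernoulli_fun z * exp (- z)"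
proof -
  have e: "0 < 1 - exp (- z)" using assms by simp
  have "1 - exp (- z) < z" using exp_minus_greater[of z] assms by simp
  then show "1 < bernoulli_fun z" using e by (simp add: bernoulli_fun_def)
  have "z * (1 - exp (- z)) < z * 1" using assms by (intro mult_strict_left_mono) auto
  then show "z < bernoulli_fun z" using e by (simp add: bernoulli_fun_def pos_less_divide_eq)
  show "bernoulli_fun z - z = bernoulli_fun z * exp (- z)"
    using e by (simp add: bernoulli_fun_def field_simps)
qed

text \<open>The numerator of the derivative is \<open>1 - (1 + x) * exp (- x)\<close>, nonnegative
  by \<open>1 + x \<le> exp x\<close>. It makes the set of admissible parameters an
  interval.\<close>

lemma bernoulli_fun_mono:
  assumes "0 < y" "y \<le> z"
  shows "bernoulli_fun y \<le> bernoulli_fun z"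
proof (rule DERIV_nonneg_imp_nondecreasing[OF assms(2)])
  fix x assume x: "y \<le> x" "x \<le> z"
  define D where "D = ((1 - exp (- x)) - x * exp (- x)) / (1 - exp (- x))\<^sup>2"
  have e: "0 < 1 - exp (- x)" using x assms by simp
  have "(1 + x) * exp (- x) \<le> exp x * exp (- x)"
    by (intro mult_right_mono exp_ge_add_one_self) simp
  then have "0 \<le> D" unfolding D_def by (intro divide_nonneg_nonneg) (auto simp: algebra_simps simp flip: exp_add)
  moreover have "(bernoulli_fun has_real_derivative D) (at x)"
    unfolding bernoulli_fun_def[abs_def] D_def using e
    by (auto intro!: derivative_eq_intros simp: power2_eq_square)
  ultimately show "\<exists>D. (bernoulli_fun has_real_derivative D) (at x) \<and> 0 \<le> D" by blast
qed

lemma continuous_on_bernoulli_fun: "continuous_on {0<..} bernoulli_fun"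
  unfolding bernoulli_fun_def[abs_def] by (intro continuous_intros) auto

lemma bernoulli_fun_surj:
  assumes "1 < y"
  obtains z where "0 < z" "bernoulli_fun z = y"
proof -
  have "(bernoulli_fun \<longlongrightarrow> 1) (at_right 0)"
    unfolding bernoulli_fun_def[abs_def] by real_asymp
  then have "\<forall>\<^sub>F z in at_right 0. bernoulli_fun z < y"
    using assms by (intro order_tendstoD(2)) auto
  moreover have "\<forall>\<^sub>F z in at_right 0. z \<in> {0<..<1::real}"
    by (rule eventually_at_right_real) simp
  ultimately have "\<forall>\<^sub>F z in at_right 0. 0 < z \<and> bernoulli_fun z < y"
    by eventually_elim auto
  then obtain a where a: "0 < a" "bernoulli_fun a < y"
    using eventually_happens'[OF trivial_limit_at_right_real] by blast
  have "is_interval {0::real<..}" by (auto simp: is_interval_1)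
  \<comment> \<open>The point \<open>y\<close> itself serves as right end, since
    \<open>bernoulli_fun y > y\<close>.\<close>
  then obtain z where "z \<in> {0<..}" "bernoulli_fun z = y"
    by (rule intermediate_value_interval[OF _ continuous_on_bernoulli_fun, of a y y])
      (use a assms bernoulli_fun_bounds(2)[of y] in auto)
  then show ?thesis using that by auto
qed

lemma even_period_attained:
  assumes L: "0 < L" and \<omega>: "omega_lower L < \<omega>" "\<omega> < 1"
  obtains p q where "0 < p" "p < q" "q < 1" "(1 - \<omega>) * log_dd2 q p = 1"
    "integral {0..pi} (\<lambda>t. 1 / even_speed \<omega> p q t) = L"
proof -
  let ?h = bernoulli_fun
  \<comment> \<open>The parameter is \<open>z = ln ((1 - p) / (1 - q))\<close>: in terms of it the equal energy
    condition \<open>q - p = (1 - \<omega>) * z\<close> can be solved explicitly for \<open>p\<close> and \<open>q\<close>.\<close>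
  define p where "p z = 1 - (1 - \<omega>) * ?h z" for z
  define q where "q z = p z + (1 - \<omega>) * z" for z
  define Z where "Z = {z. 0 < z \<and> 0 < p z}"
  define T where "T z = integral {0..pi} (\<lambda>t. 1 / even_speed \<omega> (p z) (q z) t)" for z
  \<comment> \<open>A gap between \<open>q\<close> and 1 uniform in \<open>z\<close>: positivity of
    \<open>p z\<close> forces \<open>z < 1 / (1 - \<omega>)\<close>, and
    \<open>1 - q z = (1 - \<omega>) * ?h z * exp (- z)\<close> with \<open>?h z > 1\<close>.\<close>
  define \<delta> where "\<delta> = (1 - \<omega>) * exp (- (1 / (1 - \<omega>)))"
  have "0 < omega_lower L" using L by (simp add: omega_lower_def add_pos_pos)
  then have \<omega>0: "0 < \<omega>" using \<omega> by simp
  have \<delta>: "0 < \<delta>" using \<omega> by (simp add: \<delta>_def)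
  have pq: "0 < p z" "p z < q z" "q z \<le> 1 - \<delta>" "(1 - \<omega>) * log_dd2 (q z) (p z) = 1" if "z \<in> Z" for z
  proof -
    have z: "0 < z" "0 < p z" using that by (auto simp: Z_def)
    note h = bernoulli_fun_bounds[OF z(1)]
    show "0 < p z" "p z < q z" using z \<omega> by (auto simp: q_def)
    have q: "1 - q z = (1 - \<omega>) * (?h z * exp (- z))"
      unfolding h(3)[symmetric] by (simp add: q_def p_def algebra_simps)
    have "(1 - \<omega>) * ?h z < 1" using z by (simp add: p_def)
    then have "?h z < 1 / (1 - \<omega>)" using \<omega> by (simp add: pos_less_divide_eq mult.commute)
    then have "exp (- (1 / (1 - \<omega>))) \<le> exp (- z)" using h(2) by simp
    also have "\<dots> \<le> ?h z * exp (- z)" using h(1) by simp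
    finally have "\<delta> \<le> 1 - q z" unfolding q \<delta>_def using \<omega> by (intro mult_left_mono) auto
    then show "q z \<le> 1 - \<delta>" by simp
    then have "q z < 1" "p z < 1" using \<delta> \<open>p z < q z\<close> by auto
    have "1 - p z = (1 - \<omega>) * ?h z" by (simp add: p_def)
    then have "ln (1 - p z) - ln (1 - q z) = z"
      unfolding q using h(1) \<omega> by (simp add: ln_mult)
    then have "(1 - \<omega>) * z * log_dd2 (q z) (p z) = z"
      using log_dd2_eq[OF \<open>q z < 1\<close> \<open>p z < 1\<close>] by (simp add: q_def)
    then show "(1 - \<omega>) * log_dd2 (q z) (p z) = 1" using z by (simp add: mult_ac)
  qed
  have q1: "q z < 1" if "z \<in> Z" for z using pq(3)[OF that] \<delta> by simp
  have int: "is_interval Z"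
    unfolding is_interval_1
  proof (intro ballI allI impI)
    fix a b x assume "a \<in> Z" "b \<in> Z" "a \<le> x \<and> x \<le> b"
    moreover have "(1 - \<omega>) * ?h x \<le> (1 - \<omega>) * ?h b"
      using calculation \<omega> by (intro mult_left_mono bernoulli_fun_mono) (auto simp: Z_def)
    ultimately show "x \<in> Z" by (auto simp: Z_def p_def)
  qed
  have pcont: "continuous_on Z p"
    unfolding p_def[abs_def]
    by (intro continuous_intros continuous_on_subset[OF continuous_on_bernoulli_fun]) (auto simp: Z_def)
  have qcont: "continuous_on Z q"
    unfolding q_def[abs_def] by (intro continuous_intros pcont)
  have pos: "0 < even_speed \<omega> (p z) (q z) t" if "z \<in> Z" for z t
    by (intro even_speed_pos pq q1 that \<omega>)
  have jcont: "continuous_on (Z \<times> {0..pi}) (\<lambda>(z, t). even_speed \<omega> (p z) (q z) t)"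
    by (intro continuous_on_even_speed pcont qcont conjI pq q1)
  have scont: "continuous_on {0..pi} (even_speed \<omega> (p z) (q z))" if "z \<in> Z" for z
  proof -
    have "continuous_on {0..pi} (\<lambda>t. case (z, t) of (z, t) \<Rightarrow> even_speed \<omega> (p z) (q z) t)"
      by (rule continuous_on_compose2[OF jcont]) (use that in \<open>auto intro!: continuous_intros\<close>)
    then show ?thesis by simp
  qed
  have Tcont: "continuous_on Z T"
    unfolding T_def by (intro continuous_on_integral_inverse jcont pos)
  \<comment> \<open>Every lower turning value below the equilibrium occurs: \<open>y\<close> near
    \<open>\<omega>\<close> is the small-amplitude end, \<open>y\<close> near 0 the homoclinic
    end.\<close>
  have attain: "\<exists>z. z \<in> Z \<and> p z = y" if "0 < y" "y < \<omega>" for y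
  proof -
    have "1 < (1 - y) / (1 - \<omega>)" using that \<omega> by simp
    then obtain z where "0 < z" "?h z = (1 - y) / (1 - \<omega>)" by (rule bernoulli_fun_surj)
    then show ?thesis using that \<omega> by (intro exI[of _ z]) (simp add: Z_def p_def)
  qed
  have ubounds: "p z \<le> u" "u \<le> q z" "u \<le> p z + t\<^sup>2"
    if "z \<in> Z" "u = p z + (q z - p z) * (sin t)\<^sup>2" for z t u
  proof -
    show "p z \<le> u" "u \<le> q z"
      using that(2) pq(2)[OF that(1)] mult_sin_squared_bounds[of "q z - p z" t] by linarith+
    have "(q z - p z) * (sin t)\<^sup>2 \<le> 1 * t\<^sup>2"
      using pq(1,2)[OF that(1)] q1[OF that(1)] abs_sin_x_le_abs_x[of t]
      by (intro mult_mono) (auto simp: abs_le_square_iff)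
    then show "u \<le> p z + t\<^sup>2" using that(2) by simp
  qed
  obtain z1 where z1: "z1 \<in> Z" "T z1 \<le> L"
  proof -
    \<comment> \<open>Replacing all nodes by the smallest one bounds the squared speed below by
      \<open>c y\<close> when \<open>p z = y\<close>. The limit
      \<open>\<omega> / (2 * (1 - \<omega>))\<close> is the square of half the linearised frequency,
      half because a period is a phase gain of \<open>pi\<close>.\<close>
    define c where "c y = y * ((1 - \<omega>) * (1 / (2 * (1 - y)\<^sup>2)))" for y
    have "(c \<longlongrightarrow> \<omega> * ((1 - \<omega>) * (1 / (2 * (1 - \<omega>)\<^sup>2)))) (at_left \<omega>)"
      unfolding c_def[abs_def] using \<omega> by (intro tendsto_intros) auto
    moreover have "(pi / L)\<^sup>2 < \<omega> * ((1 - \<omega>) * (1 / (2 * (1 - \<omega>)\<^sup>2)))"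
    proof -
      have "2 * pi\<^sup>2 < \<omega> * (L\<^sup>2 + 2 * pi\<^sup>2)"
        using \<omega>(1) L unfolding omega_lower_def by (simp add: pos_divide_less_eq add_pos_pos)
      then have "pi\<^sup>2 / L\<^sup>2 * (2 * (1 - \<omega>)) < \<omega>"
        using L by (simp add: pos_divide_less_eq algebra_simps)
      then have "(pi / L)\<^sup>2 < \<omega> / (2 * (1 - \<omega>))"
        using \<omega> by (subst pos_less_divide_eq) (simp_all add: power_divide)
      moreover have "\<omega> * ((1 - \<omega>) * (1 / (2 * (1 - \<omega>)\<^sup>2))) = \<omega> / (2 * (1 - \<omega>))"
        using \<omega> by (simp add: power2_eq_square)
      ultimately show ?thesis by simp
    qed
    ultimately have "\<forall>\<^sub>F y in at_left \<omega>. (pi / L)\<^sup>2 < c y"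
      by (rule order_tendstoD(1))
    moreover have "\<forall>\<^sub>F y in at_left \<omega>. y \<in> {0<..<\<omega>}"
      by (rule eventually_at_left_real[OF \<omega>0])
    ultimately have "\<forall>\<^sub>F y in at_left \<omega>. 0 < y \<and> y < \<omega> \<and> (pi / L)\<^sup>2 < c y"
      by eventually_elim auto
    then obtain y where y: "0 < y" "y < \<omega>" "(pi / L)\<^sup>2 < c y"
      using eventually_happens'[OF trivial_limit_at_left_real] by blast
    then obtain z where z: "z \<in> Z" "p z = y" using attain by blast
    have "pi / L \<le> even_speed \<omega> (p z) (q z) t" for t
    proof -
      define u where "u = p z + (q z - p z) * (sin t)\<^sup>2"
      note u = ubounds[OF z(1) u_def]
      have "y < 1" using y \<omega> by simp
      have "c y = y * ((1 - \<omega>) * log_dd3 y y y)"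
        by (simp add: c_def log_dd3_diag[OF \<open>y < 1\<close>])
      also have "\<dots> \<le> u * ((1 - \<omega>) * log_dd3 (p z) (q z) u)"
        using z y u pq(2)[OF z(1)] q1[OF z(1)] \<omega>
        by (intro mult_mono mult_nonneg_nonneg order_refl log_dd3_mono)
          (auto intro!: less_imp_le[OF log_dd3_pos])
      finally show ?thesis
        unfolding even_speed_def Let_def u_def[symmetric] using y(3) by (intro real_le_rsqrt) simp
    qed
    then have "T z \<le> pi / (pi / L)"
      unfolding T_def using L by (intro integral_inverse_le scont z) auto
    then show ?thesis using that[OF z(1)] by simp
  qed
  obtain z2 where z2: "z2 \<in> Z" "L \<le> T z2"
  proof -
    \<comment> \<open>All nodes lie below \<open>1 - \<delta>\<close>, so \<open>N\<close> stays
      fixed while \<open>p\<close> tends to 0. The factor \<open>u \<le> p + t\<^sup>2\<close> of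
      the squared speed then produces the logarithm.\<close>
    define N where "N = sqrt ((1 - \<omega>) / (2 * \<delta>\<^sup>2))"
    have N: "0 < N" "N\<^sup>2 = (1 - \<omega>) * (1 / (2 * \<delta>\<^sup>2))" using \<omega> \<delta> by (auto simp: N_def)
    have "filterlim (\<lambda>y. ln (1 + N * pi / (N * sqrt y)) / N) at_top (at_right 0)"
      using N by real_asymp
    then have "\<forall>\<^sub>F y in at_right 0. L \<le> ln (1 + N * pi / (N * sqrt y)) / N"
      by (simp add: filterlim_at_top)
    moreover have "\<forall>\<^sub>F y in at_right 0. y \<in> {0<..<\<omega>}"
      by (rule eventually_at_right_real[OF \<omega>0])
    ultimately have "\<forall>\<^sub>F y in at_right 0. 0 < y \<and> y < \<omega> \<and> L \<le> ln (1 + N * pi / (N * sqrt y)) / N"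
      by eventually_elim auto
    then obtain y where y: "0 < y" "y < \<omega>" "L \<le> ln (1 + N * pi / (N * sqrt y)) / N"
      using eventually_happens'[OF trivial_limit_at_right_real] by blast
    then obtain z where z: "z \<in> Z" "p z = y" using attain by blast
    have "even_speed \<omega> (p z) (q z) t \<le> N * sqrt y + N * t" if "t \<in> {0..pi}" for t
    proof -
      define u where "u = p z + (q z - p z) * (sin t)\<^sup>2"
      note u = ubounds[OF z(1) u_def]
      have "u * ((1 - \<omega>) * log_dd3 (p z) (q z) u) \<le> (y + t\<^sup>2) * ((1 - \<omega>) * log_dd3 (1 - \<delta>) (1 - \<delta>) (1 - \<delta>))"
        using z y u pq(2,3)[OF z(1)] q1[OF z(1)] \<omega> \<delta>
        by (intro mult_mono mult_nonneg_nonneg order_refl log_dd3_mono)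
          (auto intro!: less_imp_le[OF log_dd3_pos])
      also have "\<dots> = (y + t\<^sup>2) * N\<^sup>2"
        using \<delta> by (simp add: N(2) log_dd3_diag)
      also have "\<dots> \<le> (sqrt y + t)\<^sup>2 * N\<^sup>2"
        using y that by (intro mult_right_mono) (auto simp: power2_sum)
      finally have "u * ((1 - \<omega>) * log_dd3 (p z) (q z) u) \<le> (N * sqrt y + N * t)\<^sup>2"
        by (simp add: algebra_simps flip: power_mult_distrib)
      then show ?thesis
        unfolding even_speed_def Let_def u_def[symmetric] using N y that by (intro real_le_lsqrt) auto
    qed
    then have "ln (1 + N * pi / (N * sqrt y)) / N \<le> T z"
      unfolding T_def using N y by (intro integral_inverse_ge_ln scont pos z) auto
    then show ?thesis using that[OF z(1)] y(3) by simp
  qed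
  obtain z where "z \<in> Z" "T z = L"
    using intermediate_value_interval[OF int Tcont z1(1) z2(1) z1(2) z2(2)] by blast
  then show ?thesis using that[of "p z" "q z"] pq q1 by (auto simp: T_def)
qed

theorem theorem1p1:
  fixes L :: real
  assumes "0 < L"
  shows "(\<forall>\<omega> x0. omega_lower L < \<omega> \<and> \<omega> < 1 \<longrightarrow>
            (\<exists>\<phi>. periodic_orbit \<omega> L \<phi> \<and> smooth \<phi> \<and>
               (\<forall>x. 0 < \<phi> x \<and> \<phi> x < 1 \<and> \<phi> (x0 + x) = \<phi> (x0 - x)))) \<and>
         (\<forall>\<omega> x0. Omega_lower L < \<omega> \<and> \<omega> < 1 \<longrightarrow>
            (\<exists>\<phi>. periodic_orbit \<omega> L \<phi> \<and> smooth \<phi> \<and>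
               (\<forall>x. -1 < \<phi> x \<and> \<phi> x < 1 \<and>
                    \<phi> (x0 + x) = - \<phi> (x0 - x) \<and>
                    - \<phi> (x0 - x) = \<phi> (x0 + L / 2 - x))))"
proof (intro conjI allI impI; elim conjE)
  fix \<omega> x0 :: real
  assume \<omega>: "omega_lower L < \<omega>" "\<omega> < 1"
  obtain p q where "0 < p" "p < q" "q < 1" "(1 - \<omega>) * log_dd2 q p = 1"
    and T: "integral {0..pi} (\<lambda>t. 1 / even_speed \<omega> p q t) = L"
    using even_period_attained[OF assms \<omega>] .
  then show "\<exists>\<phi>. periodic_orbit \<omega> L \<phi> \<and> smooth \<phi> \<and>
      (\<forall>x. 0 < \<phi> x \<and> \<phi> x < 1 \<and> \<phi> (x0 + x) = \<phi> (x0 - x))"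
    using even_orbit_exists[of p q \<omega> x0] \<omega> unfolding T by simp
next
  fix \<omega> x0 :: real
  assume \<omega>: "Omega_lower L < \<omega>" "\<omega> < 1"
  obtain b where "0 < b" "b < 1" "1 < (1 - \<omega>) * log_dd2 b 0"
    and T: "2 * integral {0..pi} (\<lambda>t. 1 / odd_speed \<omega> b t) = L"
    using odd_period_attained[OF assms \<omega>] .
  then show "\<exists>\<phi>. periodic_orbit \<omega> L \<phi> \<and> smooth \<phi> \<and>
      (\<forall>x. -1 < \<phi> x \<and> \<phi> x < 1 \<and> \<phi> (x0 + x) = - \<phi> (x0 - x) \<and> - \<phi> (x0 - x) = \<phi> (x0 + L / 2 - x))"
    using odd_orbit_exists[of b \<omega> x0] \<omega> unfolding T by simp
qed

end
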